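(* Let $d\ge 1$, let $\mathcal X\subset\mathbb R^d$ be non-empty and compact, let $\|\cdot\|$ be a norm on $\mathbb R^d$, let $L>0$, and let $\varepsilon_0:=L\max_{x,y\in\mathcal X}\|x-y\|$. Suppose that there exist $r_0>\varepsilon_0/(2L)$ and $\gamma\in(0,1]$ such that $\mathrm{vol}(B_r(x)\cap\mathcal X)\ge\gamma v_r$ for all $x\in\mathcal X$ and all $r\in(0,r_0)$. Let c.DOO be the algorithm described in the context, run with a hierarchy of cells and representatives satisfying the conditions (D1) and (D2) of the context with constants $K$, $\delta$, $R$, $\nu$. Then there exist two constants $c_d,C_d>0$ such that, for all $f\in\mathcal F_L$ (with maximizer $x^\star$) and all $\varepsilon\in(0,\varepsilon_0]$, $$\frac{c_d\left(1-\frac{\mathrm{Lip}(f)}{L}\right)^d}{1+\lceil\log_2(\varepsilon_0/\varepsilon)\rceil}\int_{\mathcal X}\frac{\mathrm dx}{(f(x^\star)-f(x)+\varepsilon)^d}\;\le\;\inf_A\sigma(A,f,\varepsilon)\;\le\;\sigma(\text{c.DOO},f,\varepsilon)\;\le\;C_d\int_{\mathcal X}\frac{\mathrm dx}{(f(x^\star)-f(x)+\varepsilon)^d},$$ where the infimum is over all certified algorithms $A$ (for the constant $L$). For example, one can take $$c_d=\frac{L^d}{4\cdot2^{7d}v_1},\qquad C_d=\left(2+K\left(\mathbf 1_{\nu/R\ge1}+\mathbf 1_{\nu/R<1}(4R/\nu)^d\right)\right)\frac{(128L)^d}{v_1\gamma}.$$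
   Context: $B_\rho(x)$ is the closed $\|\cdot\|$-ball of radius $\rho$ centered at $x$, $\mathrm{vol}$ is Lebesgue measure, and $v_\rho:=\mathrm{vol}(B_\rho(0))$. For Lipschitz $f:\mathcal X\to\mathbb R$, $\mathrm{Lip}(f):=\min\{L'\ge0: |f(x)-f(y)|\le L'\|x-y\|\ \forall x,y\in\mathcal X\}$; $f$ is $L$-Lipschitz if $\mathrm{Lip}(f)\le L$. $\mathcal F_L:=\{g:\mathcal X\to\mathbb R \mid g\text{ Lipschitz and }\mathrm{Lip}(g)<L\}$. Certified algorithm (for $\mathcal X$, $\|\cdot\|$, $L$): a deterministic sequential procedure that, run on a function $f:\mathcal X\to\mathbb R$, at each round $n\ge1$ chooses a query point $x_n\in\mathcal X$ as a function of $f(x_1),\dots,f(x_{n-1})$ only ($x_1$ is fixed), observes $f(x_n)$, and then outputs, as functions of $f(x_1),\dots,f(x_n)$ only, a recommendation $x_n^\star\in\mathcal X$ and an error certificate $\xi_n\ge0$, subject to the constraint that for every $L$-Lipschitz $f:\mathcal X\to\mathbb R$ and every $n\ge1$, $\max(f)-f(x_n^\star)\le\xi_n$. Its sample complexity is $\sigma(A,f,\varepsilon):=\inf\{n\ge1:\xi_n\le\varepsilon\}\in\{1,2,\dots\}\cup\{+\infty\}$, where $\xi_n$ are the certificates output when $A$ is run on $f$. Hierarchy of cells: fix $K\in\{1,2,\dots\}$ and subsets $X_{h,i}$ of $\mathbb R^d$ ($h\in\mathbb N=\{0,1,\dots\}$, $i=0,\dots,K^h-1$), called cells, such that for each $h$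 the cells $X_{h,0},\dots,X_{h,K^h-1}$ are non-empty, pairwise disjoint, and their union contains $\mathcal X$; and for each $(h,j)$ there are $K$ distinct indices $i_1,\dots,i_K\in\{0,\dots,K^{h+1}-1\}$ such that $X_{h+1,i_1},\dots,X_{h+1,i_K}$ form a partition of $X_{h,j}$; $(h+1,i_1),\dots,(h+1,i_K)$ are called the children of $(h,j)$. Each cell has a representative $x_{h,i}\in X_{h,i}$, with $x_{h,i}\in\mathcal X$ whenever $X_{h,i}\cap\mathcal X\ne\varnothing$. Conditions: (D1) there are $\delta\in(0,1)$, $R>0$ with $\|u-v\|\le R\delta^h$ for all $h,i$ and all $u,v\in X_{h,i}$; (D2) there is $\nu>0$ with $\|x_{h,i}-x_{h',i'}\|\ge\nu\delta^{\max(h,h')}$ for all $(h,i)\ne(h',i')$. Algorithm c.DOO (certified DOO): set $n=1$ and $\mathcal L=\{(0,0)\}$; query $x_1=x_{0,0}$, recommend $x_1^\star=x_1$, output certificate $\xi_1=LR$. Then repeat for iterations $k=1,2,\dots$: choose $(h^\star,i^\star)\in\mathrm{argmax}_{(h,i)\in\mathcal L}\{f(x_{h,i})+LR\delta^h\}$ (ties broken by an arbitrary deterministic rule); for each child $(h^\star+1,j)$ of $(h^\star,i^\star)$ in turn with $X_{h^\star+1,j}\cap\mathcal X\ne\varnothing$: increase $n$ by one, add $(h^\star+1,j)$ to $\mathcal L$, query $x_n=x_{h^\star+1,j}$, output a recommendation $x_n^\star\in\mathrm{argmax}_{x\in\{x_1,\dots,x_n\}}f(x)$ and the certificate $\xi_n=f(x_{h^\star,i^\star})+LR\delta^{h^\star}-f(x_n^\star)$;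 after all children are processed, remove $(h^\star,i^\star)$ from $\mathcal L$. *)

theory Defs
  imports "HOL-Analysis.Analysis"
begin

section \<open>Norms on real vector spaces, balls, Lipschitz functions\<close>

text \<open>The norm is a parameter \<open>N\<close>, unrelated to the Euclidean \<open>norm\<close> of the type.\<close>

definition is_norm :: "('p::real_vector \<Rightarrow> real) \<Rightarrow> bool" where
  "is_norm N \<longleftrightarrow>
     (\<forall>x. 0 \<le> N x) \<and> (\<forall>x. N x = 0 \<longleftrightarrow> x = 0) \<and>
     (\<forall>a x. N (a *\<^sub>R x) = \<bar>a\<bar> * N x) \<and> (\<forall>x y. N (x + y) \<le> N x + N y)"

definition nball :: "('p::real_vector \<Rightarrow> real) \<Rightarrow> real \<Rightarrow> 'p \<Rightarrow> 'p set" where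
  "nball N \<rho> x = {y. N (y - x) \<le> \<rho>}"

definition ball_volume :: "((real ^ 'd) \<Rightarrow> real) \<Rightarrow> real \<Rightarrow> real" where
  "ball_volume N \<rho> = measure lebesgue (nball N \<rho> 0)"

text \<open>
  A function on the domain \<open>X\<close> is represented by a total function of which only the values on \<open>X\<close>
  are ever used.
\<close>

definition lipschitz_bounds ::
    "('p::real_vector \<Rightarrow> real) \<Rightarrow> 'p set \<Rightarrow> ('p \<Rightarrow> real) \<Rightarrow> real set" where
  "lipschitz_bounds N X f = {M. 0 \<le> M \<and> (\<forall>x\<in>X. \<forall>y\<in>X. \<bar>f x - f y\<bar> \<le> M * N (x - y))}"

definition is_lipschitz :: "('p::real_vector \<Rightarrow> real) \<Rightarrow> 'p set \<Rightarrow> ('p \<Rightarrow> real) \<Rightarrow> bool" where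
  "is_lipschitz N X f \<longleftrightarrow> lipschitz_bounds N X f \<noteq> {}"

definition Lip :: "('p::real_vector \<Rightarrow> real) \<Rightarrow> 'p set \<Rightarrow> ('p \<Rightarrow> real) \<Rightarrow> real" where
  "Lip N X f = Inf (lipschitz_bounds N X f)"

text \<open>The infimum is a minimum:\<close>

lemma Lip_least:
  assumes "is_norm N" and "is_lipschitz N X f"
  shows "Lip N X f \<in> lipschitz_bounds N X f"
    and "M \<in> lipschitz_bounds N X f \<Longrightarrow> Lip N X f \<le> M"
proof -
  let ?S = "lipschitz_bounds N X f"
  have ne: "?S \<noteq> {}" using assms(2) by (simp add: is_lipschitz_def)
  have bdd: "bdd_below ?S" by (rule bdd_belowI[of _ 0]) (simp add: lipschitz_bounds_def)
  show "M \<in> ?S \<Longrightarrow> Lip N X f \<le> M" unfolding Lip_def using bdd by (rule cInf_lower[rotated])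
  have "\<bar>f x - f y\<bar> \<le> Inf ?S * N (x - y)" if xy: "x \<in> X" "y \<in> X" for x y
  proof (cases "N (x - y) = 0")
    case True
    then have "x - y = 0" using assms(1) unfolding is_norm_def by blast
    then show ?thesis using True by simp
  next
    case False
    then have pos: "0 < N (x - y)" using assms(1) unfolding is_norm_def
      by (metis order_le_less)
    have "\<bar>f x - f y\<bar> / N (x - y) \<le> Inf ?S"
      by (rule cInf_greatest[OF ne]) (use xy pos in \<open>auto simp: lipschitz_bounds_def divide_le_eq\<close>)
    then show ?thesis using pos by (simp add: divide_le_eq)
  qed
  moreover have "0 \<le> Inf ?S" by (rule cInf_greatest[OF ne]) (simp add: lipschitz_bounds_def)
  ultimately show "Lip N X f \<in> ?S" by (simp add: Lip_def lipschitz_bounds_def)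
qed

definition L_lipschitz ::
    "('p::real_vector \<Rightarrow> real) \<Rightarrow> 'p set \<Rightarrow> real \<Rightarrow> ('p \<Rightarrow> real) \<Rightarrow> bool" where
  "L_lipschitz N X L f \<longleftrightarrow> is_lipschitz N X f \<and> Lip N X f \<le> L"

definition F_class ::
    "('p::real_vector \<Rightarrow> real) \<Rightarrow> 'p set \<Rightarrow> real \<Rightarrow> ('p \<Rightarrow> real) set" where
  "F_class N X L = {f. is_lipschitz N X f \<and> Lip N X f < L}"


section \<open>Certified algorithms\<close>

text \<open>
  An algorithm maps the list of values observed so far, in chronological order, to its next query
  point, and (once at least one value is known) to its recommendation and its certificate.
\<close>

record 'p algorithm =
  query :: "real list \<Rightarrow> 'p"
  recommend :: "real list \<Rightarrow> 'p"
  certify :: "real list \<Rightarrow> real"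

primrec observed :: "'p algorithm \<Rightarrow> ('p \<Rightarrow> real) \<Rightarrow> nat \<Rightarrow> real list" where
  "observed A f 0 = []"
| "observed A f (Suc n) = observed A f n @ [f (query A (observed A f n))]"

text \<open>The point queried, and the outputs produced, in round \<open>n \<ge> 1\<close>:\<close>

definition query_point :: "'p algorithm \<Rightarrow> ('p \<Rightarrow> real) \<Rightarrow> nat \<Rightarrow> 'p" where
  "query_point A f n = query A (observed A f (n - 1))"

definition recommendation :: "'p algorithm \<Rightarrow> ('p \<Rightarrow> real) \<Rightarrow> nat \<Rightarrow> 'p" where
  "recommendation A f n = recommend A (observed A f n)"

definition certificate :: "'p algorithm \<Rightarrow> ('p \<Rightarrow> real) \<Rightarrow> nat \<Rightarrow> real" where
  "certificate A f n = certify A (observed A f n)"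

text \<open>
  Nonnegativity of certificates is required on \<open>L\<close>-Lipschitz functions only: on other functions
  certificates carry no meaning, and those of c.DOO can be negative there. Truncating certificates
  at zero shows that requiring it on all functions would not change the infimum, over certified
  algorithms, of the sample complexity on an \<open>L\<close>-Lipschitz function.
\<close>

definition certified_algorithms ::
    "('p::real_vector \<Rightarrow> real) \<Rightarrow> 'p set \<Rightarrow> real \<Rightarrow> 'p algorithm set" where
  "certified_algorithms N X L = {A.
     (\<forall>f. \<forall>n\<ge>1. query_point A f n \<in> X \<and> recommendation A f n \<in> X) \<and>
     (\<forall>f. L_lipschitz N X L f \<longrightarrow>
        (\<forall>n\<ge>1. 0 \<le> certificate A f n \<and>
                (SUP x\<in>X. f x) - f (recommendation A f n) \<le> certificate A f n))}"

definition sample_complexity :: "'p algorithm \<Rightarrow> ('p \<Rightarrow> real) \<Rightarrow> real \<Rightarrow> enat" where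
  "sample_complexity A f \<epsilon> = Inf {enat n | n. 1 \<le> n \<and> certificate A f n \<le> \<epsilon>}"


section \<open>Hierarchies of cells\<close>

text \<open>
  \<open>C h i\<close> is the cell with index \<open>(h, i)\<close> and \<open>rep h i\<close> its representative. The list \<open>ch h j\<close>
  contains the indices (at depth \<open>h + 1\<close>) of the children of \<open>(h, j)\<close>, in the order in which c.DOO
  goes through them. As cells of equal depth are non-empty and pairwise disjoint, the set of
  children is determined by \<open>C\<close>, and the children partition their parent as soon as their union
  is the parent.
\<close>

definition cell_hierarchy ::
    "'p set \<Rightarrow> nat \<Rightarrow> (nat \<Rightarrow> nat \<Rightarrow> 'p set) \<Rightarrow> (nat \<Rightarrow> nat \<Rightarrow> nat list) \<Rightarrow>
     (nat \<Rightarrow> nat \<Rightarrow> 'p) \<Rightarrow> bool" where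
  "cell_hierarchy X K C ch rep \<longleftrightarrow>
     1 \<le> K \<and>
     (\<forall>h. (\<forall>i<K ^ h. C h i \<noteq> {}) \<and> disjoint_family_on (C h) {..<K ^ h} \<and>
          X \<subseteq> (\<Union>i<K ^ h. C h i)) \<and>
     (\<forall>h. \<forall>j<K ^ h. distinct (ch h j) \<and> length (ch h j) = K \<and> set (ch h j) \<subseteq> {..<K ^ Suc h} \<and>
          (\<Union>i\<in>set (ch h j). C (Suc h) i) = C h j) \<and>
     (\<forall>h. \<forall>i<K ^ h. rep h i \<in> C h i \<and> (C h i \<inter> X \<noteq> {} \<longrightarrow> rep h i \<in> X))"

definition cond_D1 ::
    "('p::real_vector \<Rightarrow> real) \<Rightarrow> nat \<Rightarrow> (nat \<Rightarrow> nat \<Rightarrow> 'p set) \<Rightarrow> real \<Rightarrow> real \<Rightarrow> bool" where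
  "cond_D1 N K C \<delta> R \<longleftrightarrow>
     0 < \<delta> \<and> \<delta> < 1 \<and> 0 < R \<and>
     (\<forall>h. \<forall>i<K ^ h. \<forall>u\<in>C h i. \<forall>v\<in>C h i. N (u - v) \<le> R * \<delta> ^ h)"

definition cond_D2 ::
    "('p::real_vector \<Rightarrow> real) \<Rightarrow> nat \<Rightarrow> (nat \<Rightarrow> nat \<Rightarrow> 'p) \<Rightarrow> real \<Rightarrow> real \<Rightarrow> bool" where
  "cond_D2 N K rep \<delta> \<nu> \<longleftrightarrow>
     0 < \<nu> \<and>
     (\<forall>h h'. \<forall>i<K ^ h. \<forall>i'<K ^ h'. (h, i) \<noteq> (h', i') \<longrightarrow>
        N (rep h i - rep h' i') \<ge> \<nu> * \<delta> ^ max h h')"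


section \<open>The algorithm c.DOO\<close>

text \<open>
  A selection rule picks an element of a non-empty set of cells. It may depend on the values
  observed so far; since these determine the state of c.DOO, this covers every deterministic way of
  breaking ties.
\<close>

definition selection_rule :: "(real list \<Rightarrow> (nat \<times> nat) set \<Rightarrow> nat \<times> nat) \<Rightarrow> bool" where
  "selection_rule s \<longleftrightarrow> (\<forall>ys S. S \<noteq> {} \<longrightarrow> s ys S \<in> S)"

text \<open>
  The state after some number of observations: \<open>leaves\<close> is the set written \<open>\<L>\<close> in pseudocode,
  \<open>expanding\<close> is the cell \<open>(h\<^sup>\<star>, i\<^sup>\<star>)\<close> of the current iteration (\<open>None\<close> before the first one),
  \<open>todo\<close> lists the cells still to be queried in this iteration, and \<open>evals\<close> lists the cells
  queried so far with the values observed there. Like any other cell, the root enters \<open>leaves\<close>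
  when its value is observed.
\<close>

record doo_state =
  leaves :: "(nat \<times> nat) set"
  expanding :: "(nat \<times> nat) option"
  todo :: "(nat \<times> nat) list"
  evals :: "((nat \<times> nat) \<times> real) list"

definition doo_init :: doo_state where
  "doo_init = \<lparr>leaves = {}, expanding = None, todo = [(0, 0)], evals = []\<rparr>"

definition cell_value :: "doo_state \<Rightarrow> nat \<times> nat \<Rightarrow> real" where
  "cell_value s c = the (map_of (evals s) c)"

definition upper_value :: "real \<Rightarrow> real \<Rightarrow> real \<Rightarrow> doo_state \<Rightarrow> nat \<times> nat \<Rightarrow> real" where
  "upper_value L R \<delta> s c = cell_value s c + L * R * \<delta> ^ fst c"

text \<open>
  The end of one iteration (removal of the expanded cell) and the beginning of the next one:
\<close>

definition next_iteration ::
    "'p set \<Rightarrow> real \<Rightarrow> real \<Rightarrow> real \<Rightarrow> (nat \<Rightarrow> nat \<Rightarrow> 'p set) \<Rightarrow> (nat \<Rightarrow> nat \<Rightarrow> nat list) \<Rightarrow>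
     (real list \<Rightarrow> (nat \<times> nat) set \<Rightarrow> nat \<times> nat) \<Rightarrow> doo_state \<Rightarrow> doo_state" where
  "next_iteration X L R \<delta> C ch tie s =
     (let M = leaves s - set_option (expanding s);
          (h, i) = tie (map snd (evals s)) {c. is_arg_max (upper_value L R \<delta> s) (\<lambda>c. c \<in> M) c}
      in s\<lparr>leaves := M,
           expanding := Some (h, i),
           todo := map (Pair (Suc h)) (filter (\<lambda>j. C (Suc h) j \<inter> X \<noteq> {}) (ch h i))\<rparr>)"

definition doo_ready ::
    "'p set \<Rightarrow> real \<Rightarrow> real \<Rightarrow> real \<Rightarrow> (nat \<Rightarrow> nat \<Rightarrow> 'p set) \<Rightarrow> (nat \<Rightarrow> nat \<Rightarrow> nat list) \<Rightarrow>
     (real list \<Rightarrow> (nat \<times> nat) set \<Rightarrow> nat \<times> nat) \<Rightarrow> doo_state \<Rightarrow> doo_state" where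
  "doo_ready X L R \<delta> C ch tie s =
     (if todo s = [] then next_iteration X L R \<delta> C ch tie s else s)"

text \<open>Processing of the value \<open>y\<close> observed at the representative of the first cell to be queried:\<close>

definition doo_observe ::
    "'p set \<Rightarrow> real \<Rightarrow> real \<Rightarrow> real \<Rightarrow> (nat \<Rightarrow> nat \<Rightarrow> 'p set) \<Rightarrow> (nat \<Rightarrow> nat \<Rightarrow> nat list) \<Rightarrow>
     (real list \<Rightarrow> (nat \<times> nat) set \<Rightarrow> nat \<times> nat) \<Rightarrow> real \<Rightarrow> doo_state \<Rightarrow> doo_state" where
  "doo_observe X L R \<delta> C ch tie y s =
     (let s' = doo_ready X L R \<delta> C ch tie s; c = hd (todo s')
      in s'\<lparr>leaves := insert c (leaves s'), todo := tl (todo s'), evals := evals s' @ [(c, y)]\<rparr>)"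

definition doo_after ::
    "'p set \<Rightarrow> real \<Rightarrow> real \<Rightarrow> real \<Rightarrow> (nat \<Rightarrow> nat \<Rightarrow> 'p set) \<Rightarrow> (nat \<Rightarrow> nat \<Rightarrow> nat list) \<Rightarrow>
     (real list \<Rightarrow> (nat \<times> nat) set \<Rightarrow> nat \<times> nat) \<Rightarrow> real list \<Rightarrow> doo_state" where
  "doo_after X L R \<delta> C ch tie ys = fold (doo_observe X L R \<delta> C ch tie) ys doo_init"

text \<open>The cell whose representative is recommended:\<close>

definition incumbent ::
    "(real list \<Rightarrow> (nat \<times> nat) set \<Rightarrow> nat \<times> nat) \<Rightarrow> doo_state \<Rightarrow> nat \<times> nat" where
  "incumbent pick s =
     pick (map snd (evals s)) {c. is_arg_max (cell_value s) (\<lambda>c. c \<in> fst ` set (evals s)) c}"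

definition doo_certificate ::
    "real \<Rightarrow> real \<Rightarrow> real \<Rightarrow> (real list \<Rightarrow> (nat \<times> nat) set \<Rightarrow> nat \<times> nat) \<Rightarrow> doo_state \<Rightarrow> real" where
  "doo_certificate L R \<delta> pick s =
     (case expanding s of
        None \<Rightarrow> L * R
      | Some c \<Rightarrow> upper_value L R \<delta> s c - cell_value s (incumbent pick s))"

text \<open>\<open>tie\<close> breaks ties between cells to expand, \<open>pick\<close> between points to recommend.\<close>

definition cDOO ::
    "'p set \<Rightarrow> real \<Rightarrow> real \<Rightarrow> real \<Rightarrow> (nat \<Rightarrow> nat \<Rightarrow> 'p set) \<Rightarrow> (nat \<Rightarrow> nat \<Rightarrow> nat list) \<Rightarrow>
     (nat \<Rightarrow> nat \<Rightarrow> 'p) \<Rightarrow> (real list \<Rightarrow> (nat \<times> nat) set \<Rightarrow> nat \<times> nat) \<Rightarrow>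
     (real list \<Rightarrow> (nat \<times> nat) set \<Rightarrow> nat \<times> nat) \<Rightarrow> 'p algorithm" where
  "cDOO X L R \<delta> C ch rep tie pick =
     \<lparr>query = (\<lambda>ys. case_prod rep (hd (todo (doo_ready X L R \<delta> C ch tie
                      (doo_after X L R \<delta> C ch tie ys))))),
      recommend = (\<lambda>ys. case_prod rep (incumbent pick (doo_after X L R \<delta> C ch tie ys))),
      certify = (\<lambda>ys. doo_certificate L R \<delta> pick (doo_after X L R \<delta> C ch tie ys))\<rparr>"

end

theory Submission
  imports Defs
begin

text \<open>
  Write \<open>gap x = f x\<^sub>m - f x\<close> and \<open>I\<close> for the integral of \<open>(gap x + \<epsilon>)\<^sup>-\<^sup>d\<close> over \<open>X\<close>. Both bounds compare
  \<open>I\<close> with a number of balls whose radii are of the order \<open>(gap p + \<epsilon>) / L\<close> at their centres \<open>p\<close>. On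
  such a ball the integrand is comparable to the inverse of the volume of the ball, because \<open>f\<close> is
  Lipschitz; so every ball contributes a constant to \<open>I\<close>. Balls that cover \<open>X\<close> bound \<open>I\<close> from above
  (\<open>gap_integral_le_card_cover\<close>), disjoint balls bound it from below
  (\<open>card_separated_le_gap_integral\<close>). As the radius follows the gap, a single family of
  balls treats all scales of the gap at once.

  Lower bound on the sample complexity. Let a certified algorithm output a certificate at most \<open>\<epsilon>\<close>
  after \<open>n\<close> queries. The certificate must also be valid for the largest \<open>L\<close>-Lipschitz function that
  agrees with \<open>f\<close> at the queried points and at the recommended point, since the algorithm cannot tell
  it from \<open>f\<close>. That function therefore exceeds \<open>f x\<^sub>m\<close> by at most \<open>\<epsilon>\<close>, which means that the balls of
  radius \<open>(gap p + \<epsilon>) / L\<close> around these \<open>n + 1\<close> points \<open>p\<close> cover \<open>X\<close> (\<open>certified_cover\<close>). The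
  hypothesis \<open>Lip f < L\<close> keeps the gap on each ball from dropping much below its value at the centre.

  Upper bound for c.DOO. The leaves and the cells about to be queried always cover \<open>X\<close>, so an expanded
  cell, which has the largest upper value, bounds \<open>f x\<^sub>m\<close> from above. This yields both the validity of
  the certificates (\<open>alg_certified\<close>) and \<open>gap p \<le> L * R * \<delta> ^ h\<close> for the representative \<open>p\<close> of an
  expanded cell of depth \<open>h\<close>. As long as the certificates exceed \<open>\<epsilon>\<close>, also \<open>\<epsilon> < L * R * \<delta> ^ h\<close>. By
  \<open>cond_D2\<close>, two such representatives are then separated in proportion to the smaller of their two values
  of \<open>max gap \<epsilon>\<close>, and balls of proportional radii around them are disjoint; the volume condition on
  \<open>X\<close> turns this into a bound on the number of expanded cells (\<open>card_expanded_le\<close>). Each expansion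
  costs at most \<open>K\<close> queries.
\<close>

section \<open>Volumes of the balls of an arbitrary norm\<close>

locale lipschitz_domain =
  fixes N :: "real ^ 'd \<Rightarrow> real" and X :: "(real ^ 'd) set" and L :: real
  assumes norm: "is_norm N" and nonempty: "X \<noteq> {}" and compact: "compact X" and L_pos: "0 < L"
begin

lemma N_nonneg: "0 \<le> N x"
  and N_eq_0: "N x = 0 \<longleftrightarrow> x = 0"
  and N_scale: "N (a *\<^sub>R x) = \<bar>a\<bar> * N x"
  and N_triangle: "N (x + y) \<le> N x + N y"
  using norm unfolding is_norm_def by blast+

lemma N_commute: "N (x - y) = N (y - x)"
  using N_scale[of "-1" "x - y"] by simp

lemma N_triangle_diff: "N (x - z) \<le> N (x - y) + N (y - z)"
  using N_triangle[of "x - y" "y - z"] by simp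

lemma continuous_N: "continuous_on UNIV N"
proof (rule convex_on_continuous)
  show "convex_on UNIV N"
  proof (rule convex_onI)
    fix t :: real and x y :: "real ^ 'd" assume "0 < t" "t < 1"
    then show "N ((1 - t) *\<^sub>R x + t *\<^sub>R y) \<le> (1 - t) * N x + t * N y"
      using N_triangle[of "(1 - t) *\<^sub>R x" "t *\<^sub>R y"] by (simp add: N_scale)
  qed simp
qed simp

text \<open>
  All norms on a finite-dimensional space are equivalent: a continuous norm is bounded away from
  zero on the compact Euclidean sphere. This makes the balls of \<open>N\<close> bounded, hence of finite volume.
\<close>

lemma N_ge_Euclidean: obtains c where "0 < c" "\<And>x. c * norm x \<le> N x"
proof -
  obtain e where e: "norm (e :: real ^ 'd) = 1"
    using vector_choose_size[of 1] by auto
  have "\<exists>x0\<in>sphere 0 1. \<forall>x\<in>sphere 0 1. N x0 \<le> N x"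
    by (rule continuous_attains_inf)
       (use e in \<open>auto intro: continuous_on_subset[OF continuous_N]\<close>)
  then obtain x0 where x0: "norm x0 = 1" "\<And>x. norm x = 1 \<Longrightarrow> N x0 \<le> N x" by auto
  have "N x0 > 0" using x0(1) N_nonneg[of x0] N_eq_0[of x0] by (metis less_eq_real_def norm_zero zero_neq_one)
  moreover have "N x0 * norm x \<le> N x" for x
  proof (cases "x = 0")
    case False
    then show ?thesis using x0(2)[of "(1 / norm x) *\<^sub>R x"] by (simp add: N_scale field_simps)
  qed (use N_nonneg in simp)
  ultimately show ?thesis by (rule that)
qed

lemma compact_nball: "compact (nball N r x)"
proof -
  obtain c where c: "0 < c" "\<And>x. c * norm x \<le> N x" using N_ge_Euclidean by blast
  have "nball N r x \<subseteq> cball x (r / c)"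
  proof
    fix y assume "y \<in> nball N r x"
    then have "c * norm (y - x) \<le> r" using c(2)[of "y - x"] by (simp add: nball_def)
    then show "y \<in> cball x (r / c)"
      using c(1) by (simp add: dist_norm norm_minus_commute field_simps)
  qed
  moreover have "closed (nball N r x)" unfolding nball_def
    by (intro closed_Collect_le continuous_on_compose2[OF continuous_N] continuous_intros) auto
  ultimately show ?thesis
    using bounded_subset bounded_cball compact_eq_bounded_closed by blast
qed

lemma measure_nball:
  assumes "0 < r"
  shows "measure lebesgue (nball N r x) = r ^ CARD('d) * ball_volume N 1"
proof -
  have "nball N r x = (\<lambda>y. x + r *\<^sub>R y) ` nball N 1 0"
  proof (intro equalityI subsetI)
    fix y assume "y \<in> nball N r x"
    then have "N ((1 / r) *\<^sub>R (y - x)) \<le> 1"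
      using assms by (simp only: N_scale) (simp add: nball_def)
    moreover have "y = x + r *\<^sub>R ((1 / r) *\<^sub>R (y - x))" using assms by simp
    ultimately show "y \<in> (\<lambda>y. x + r *\<^sub>R y) ` nball N 1 0"
      unfolding nball_def by (intro image_eqI[where x = "(1 / r) *\<^sub>R (y - x)"]) simp_all
  next
    fix y assume "y \<in> (\<lambda>y. x + r *\<^sub>R y) ` nball N 1 0"
    then show "y \<in> nball N r x" using assms by (auto simp: nball_def N_scale)
  qed
  then show ?thesis
    using assms measure_lebesgue_affine[of r x "nball N 1 0"]
    by (simp add: ball_volume_def add.commute)
qed

lemma ball_volume_pos: "0 < ball_volume N 1"
proof -
  have "isCont N 0" using continuous_N by (simp add: continuous_on_eq_continuous_at)
  then obtain s where s: "0 < s" "\<And>y. norm y < s \<Longrightarrow> \<bar>N y - N 0\<bar> < 1"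
    unfolding continuous_at_eps_delta dist_norm by (metis diff_zero real_norm_def zero_less_one)
  have "ball 0 s \<subseteq> nball N 1 0"
  proof
    fix y :: "real ^ 'd" assume "y \<in> ball 0 s"
    then show "y \<in> nball N 1 0" using s(2)[of y] N_eq_0[of 0] by (auto simp: nball_def)
  qed
  then have "measure lebesgue (ball (0 :: real ^ 'd) s) \<le> ball_volume N 1"
    unfolding ball_volume_def
    by (intro measure_mono_fmeasurable) (auto simp: lmeasurable_compact compact_nball)
  moreover have "0 < measure lebesgue (ball (0 :: real ^ 'd) s)"
    using s(1) by (simp add: content_ball_pos)
  ultimately show ?thesis by linarith
qed

lemma ball_volume_scale: "0 < r \<Longrightarrow> ball_volume N r = r ^ CARD('d) * ball_volume N 1"
  using measure_nball[of r 0] by (simp add: ball_volume_def)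

section \<open>Lipschitz functions\<close>

lemma Lip_bound:
  assumes "is_lipschitz N X f" "x \<in> X" "y \<in> X"
  shows "\<bar>f x - f y\<bar> \<le> Lip N X f * N (x - y)"
  using Lip_least(1)[OF norm assms(1)] assms(2,3) by (simp add: lipschitz_bounds_def)

lemma Lip_nonneg: "is_lipschitz N X f \<Longrightarrow> 0 \<le> Lip N X f"
  using Lip_least(1)[OF norm] by (auto simp: lipschitz_bounds_def)

lemma L_lipschitz_iff:
  "L_lipschitz N X L f \<longleftrightarrow> (\<forall>x\<in>X. \<forall>y\<in>X. \<bar>f x - f y\<bar> \<le> L * N (x - y))"
proof
  assume f: "L_lipschitz N X L f"
  show "\<forall>x\<in>X. \<forall>y\<in>X. \<bar>f x - f y\<bar> \<le> L * N (x - y)"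
  proof (intro ballI)
    fix x y assume xy: "x \<in> X" "y \<in> X"
    have "\<bar>f x - f y\<bar> \<le> Lip N X f * N (x - y)"
      using f xy Lip_bound by (simp add: L_lipschitz_def)
    also have "\<dots> \<le> L * N (x - y)"
      using f N_nonneg by (auto simp: L_lipschitz_def intro: mult_right_mono)
    finally show "\<bar>f x - f y\<bar> \<le> L * N (x - y)" .
  qed
next
  assume "\<forall>x\<in>X. \<forall>y\<in>X. \<bar>f x - f y\<bar> \<le> L * N (x - y)"
  then have L: "L \<in> lipschitz_bounds N X f" using L_pos by (simp add: lipschitz_bounds_def)
  then have "is_lipschitz N X f" by (auto simp: is_lipschitz_def)
  then show "L_lipschitz N X L f" using Lip_least(2)[OF norm _ L] by (simp add: L_lipschitz_def)
qed

lemma bdd_above_N_diff: "bdd_above {N (x - y) | x y. x \<in> X \<and> y \<in> X}"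
proof -
  have "compact ((\<lambda>p. N (fst p - snd p)) ` (X \<times> X))"
    by (intro compact_continuous_image compact_Times compact
          continuous_on_compose2[OF continuous_N] continuous_intros) auto
  then have "bdd_above ((\<lambda>p. N (fst p - snd p)) ` (X \<times> X))"
    by (rule bounded_imp_bdd_above[OF compact_imp_bounded])
  moreover have "(\<lambda>p. N (fst p - snd p)) ` (X \<times> X) = {N (x - y) | x y. x \<in> X \<and> y \<in> X}"
    by force
  ultimately show ?thesis by simp
qed

lemma N_diff_le_diameter:
  assumes "x \<in> X" "y \<in> X"
  shows "N (x - y) \<le> Sup {N (x - y) | x y. x \<in> X \<and> y \<in> X}"
  by (rule cSup_upper[OF _ bdd_above_N_diff]) (use assms in blast)

lemma L_lipschitz_continuous:
  assumes "L_lipschitz N X L f"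
  shows "continuous_on X f"
proof (unfold continuous_on_def, intro ballI)
  fix x assume x: "x \<in> X"
  have "continuous_on X (\<lambda>y. L * N (y - x))"
    by (intro continuous_on_compose2[OF continuous_N] continuous_intros) auto
  then have "((\<lambda>y. L * N (y - x)) \<longlongrightarrow> L * N (x - x)) (at x within X)"
    using x by (auto simp: continuous_on_def)
  then have "((\<lambda>y. L * N (y - x)) \<longlongrightarrow> 0) (at x within X)" using N_eq_0[of 0] by simp
  then show "(f \<longlongrightarrow> f x) (at x within X)"
  proof (rule Lim_transform_bound[where f = "\<lambda>y. f y - f x", THEN LIM_zero_cancel, rotated])
    show "\<forall>\<^sub>F y in at x within X. norm (f y - f x) \<le> norm (L * N (y - x))"
      unfolding eventually_at_topological
      using assms x L_pos N_nonneg by (auto simp: L_lipschitz_iff abs_mult intro: exI[of _ UNIV])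
  qed
qed

lemma L_lipschitz_bdd_above: "L_lipschitz N X L f \<Longrightarrow> bdd_above (f ` X)"
  by (intro bounded_imp_bdd_above compact_imp_bounded compact_continuous_image
        L_lipschitz_continuous compact)

section \<open>Comparing the integral with numbers of balls\<close>

lemma integral_weighted_indicators:
  fixes k :: "'i \<Rightarrow> real"
  assumes "\<And>i. B i \<in> lmeasurable"
  shows "integrable lebesgue (\<lambda>x. \<Sum>i\<in>I. k i * indicator (B i) x)"
    and "(LINT x|lebesgue. (\<Sum>i\<in>I. k i * indicator (B i) x)) = (\<Sum>i\<in>I. k i * measure lebesgue (B i))"
proof -
  have int: "integrable lebesgue (\<lambda>x. k i * indicator (B i) x)" for i
    using assms[of i] by (intro integrable_mult_right integrable_real_indicator) (auto simp: fmeasurable_def)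
  then show "integrable lebesgue (\<lambda>x. \<Sum>i\<in>I. k i * indicator (B i) x)"
    by (intro Bochner_Integration.integrable_sum)
  show "(LINT x|lebesgue. (\<Sum>i\<in>I. k i * indicator (B i) x)) = (\<Sum>i\<in>I. k i * measure lebesgue (B i))"
    using int by (subst Bochner_Integration.integral_sum) simp_all
qed

definition gap_integral :: "(real ^ 'd \<Rightarrow> real) \<Rightarrow> real ^ 'd \<Rightarrow> real \<Rightarrow> real" where
  "gap_integral f x\<^sub>m \<epsilon> = (LINT x:X|lebesgue. 1 / (f x\<^sub>m - f x + \<epsilon>) ^ CARD('d))"

context
  fixes f :: "real ^ 'd \<Rightarrow> real" and x\<^sub>m :: "real ^ 'd" and \<epsilon> :: real
  assumes f: "L_lipschitz N X L f" and x\<^sub>m: "x\<^sub>m \<in> X" "\<And>x. x \<in> X \<Longrightarrow> f x \<le> f x\<^sub>m"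
    and eps: "0 < \<epsilon>"
begin

lemma gap_integrable: "set_integrable lebesgue X (\<lambda>x. 1 / (f x\<^sub>m - f x + \<epsilon>) ^ CARD('d))"
proof -
  have "f x\<^sub>m - f x + \<epsilon> \<noteq> 0" if "x \<in> X" for x using x\<^sub>m(2)[OF that] eps by linarith
  then have "integrable lborel (\<lambda>x. indicator X x *\<^sub>R (1 / (f x\<^sub>m - f x + \<epsilon>) ^ CARD('d)))"
    by (intro borel_integrable_compact compact continuous_intros L_lipschitz_continuous f) auto
  then show ?thesis
    unfolding set_integrable_def by (subst integrable_completion) auto
qed

text \<open>
  The points \<open>p i\<close> are separated on the scale of the smaller of the values \<open>m\<close>, and \<open>m\<close>, being the
  maximum of the gap and of \<open>\<epsilon>\<close>, is \<open>L\<close>-Lipschitz. If the balls of radii \<open>q / 4 * m i / L\<close> and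
  \<open>q / 4 * m j / L\<close> met, the Lipschitz property would make \<open>m i\<close> and \<open>m j\<close> comparable, and their
  centres would be closer than the separation permits. On each of these disjoint balls the integrand
  is at least \<open>(9 / 4 * m i)\<^sup>-\<^sup>d\<close>, and the ball meets \<open>X\<close> in a volume of at least a constant
  times \<open>\<gamma> * (m i)\<^sup>d\<close>, so it contributes at least \<open>ball_volume N 1 * \<gamma> * (q / (9 * L))\<^sup>d\<close> to the integral.
\<close>

lemma card_separated_le_gap_integral:
  fixes p :: "'i \<Rightarrow> real ^ 'd" and q \<gamma> r\<^sub>0 :: real
  defines "m \<equiv> \<lambda>i. max (f x\<^sub>m - f (p i)) \<epsilon>"
  assumes volume: "\<And>x r. x \<in> X \<Longrightarrow> 0 < r \<Longrightarrow> r < r\<^sub>0 \<Longrightarrow>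
                   \<gamma> * ball_volume N r \<le> measure lebesgue (nball N r x \<inter> X)"
    and gamma: "0 < \<gamma>" and q: "0 < q" "q \<le> 1" and fin: "finite I"
    and p: "\<And>i. i \<in> I \<Longrightarrow> p i \<in> X" and small: "\<And>i. i \<in> I \<Longrightarrow> m i < 4 * L * r\<^sub>0"
    and sep: "\<And>i j. i \<in> I \<Longrightarrow> j \<in> I \<Longrightarrow> i \<noteq> j \<Longrightarrow> q * min (m i) (m j) \<le> L * N (p i - p j)"
  shows "real (card I) \<le> (9 * L / q) ^ CARD('d) / (ball_volume N 1 * \<gamma>) * gap_integral f x\<^sub>m \<epsilon>"
proof -
  let ?n = "CARD('d)"
  define r where "r i = q / 4 * m i / L" for i
  define k where "k i = 1 / (9 / 4 * m i) ^ ?n" for i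
  have m_pos: "0 < m i" for i using eps by (simp add: m_def)
  have r_pos: "0 < r i" for i using m_pos q L_pos by (simp add: r_def)
  have r_le: "L * r i \<le> m i / 4" for i
    using q L_pos m_pos[of i] by (simp add: r_def field_simps)
  have k_pos: "0 < k i" for i using m_pos[of i] by (simp add: k_def)
  \<comment> \<open>The roles of \<open>i\<close> and \<open>j\<close> are fixed by \<open>m j \<le> m i\<close>, so that the separation is \<open>q * m j\<close>.\<close>
  have disj: "i = j" if ij: "i \<in> I" "j \<in> I" and le: "m j \<le> m i"
    and y: "y \<in> nball N (r i) (p i)" "y \<in> nball N (r j) (p j)" for i j y
  proof (rule ccontr)
    assume "i \<noteq> j"
    then have "q * m j \<le> L * N (p i - p j)" using sep[OF ij] le by (simp add: min_def split: if_splits)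
    moreover have "N (p i - p j) \<le> r i + r j"
      using y N_triangle_diff[of "p i" "p j" y] N_commute[of "p i" y] by (simp add: nball_def)
    then have "L * N (p i - p j) \<le> L * (r i + r j)" using L_pos by simp
    then have close: "L * N (p i - p j) \<le> q / 4 * m i + q / 4 * m j"
      using L_pos by (simp add: r_def distrib_left)
    moreover have "f (p j) - f (p i) \<le> L * N (p i - p j)"
      using f p[OF ij(1)] p[OF ij(2)] unfolding L_lipschitz_iff by (metis abs_le_D2 minus_diff_eq)
    then have "m i - m j \<le> L * N (p i - p j)"
      using mult_nonneg_nonneg[OF less_imp_le[OF L_pos] N_nonneg[of "p i - p j"]]
      by (simp add: m_def max_def)
    moreover have "q / 4 * m i \<le> 1 / 4 * m i" "q / 4 * m j \<le> 1 / 4 * m j"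
      using q m_pos[of i] m_pos[of j] by (simp_all add: mult_right_mono)
    ultimately have "m i \<le> 5 / 3 * m j" by linarith
    then have "q * m i \<le> q * (5 / 3 * m j)" using q by simp
    then have "q * m i \<le> 5 / 3 * (q * m j)" by simp
    moreover have "0 < q * m j" using q m_pos[of j] by simp
    ultimately show False using \<open>q * m j \<le> _\<close> close by (simp add: field_simps)
  qed
  have below: "k i \<le> 1 / (f x\<^sub>m - f y + \<epsilon>) ^ ?n"
    if i: "i \<in> I" and y: "y \<in> nball N (r i) (p i) \<inter> X" for i y
  proof -
    have "f (p i) - f y \<le> L * N (y - p i)"
      using f p[OF i] y N_commute by (force simp: L_lipschitz_iff abs_le_iff)
    also have "\<dots> \<le> L * r i" using y L_pos by (simp add: nball_def)
    also note r_le
    finally have "f (p i) - f y \<le> m i / 4" .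
    moreover have "f x\<^sub>m - f (p i) \<le> m i" "\<epsilon> \<le> m i" by (simp_all add: m_def)
    ultimately have "f x\<^sub>m - f y + \<epsilon> \<le> 9 / 4 * m i" by linarith
    moreover have "0 < f x\<^sub>m - f y + \<epsilon>" using x\<^sub>m(2)[of y] y eps by simp
    ultimately show ?thesis unfolding k_def
      by (intro divide_left_mono power_mono mult_pos_pos zero_less_power) auto
  qed
  have pointwise: "(\<Sum>i\<in>I. k i * indicat_real (nball N (r i) (p i) \<inter> X) y)
      \<le> indicator X y *\<^sub>R (1 / (f x\<^sub>m - f y + \<epsilon>) ^ ?n)" for y
  proof (cases "\<exists>i\<in>I. y \<in> nball N (r i) (p i) \<inter> X")
    case True
    then obtain i where i: "i \<in> I" "y \<in> nball N (r i) (p i) \<inter> X" by blast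
    have "(\<Sum>j\<in>I. k j * indicat_real (nball N (r j) (p j) \<inter> X) y) = (\<Sum>j\<in>I. if j = i then k j else 0)"
    proof (rule sum.cong)
      fix j assume j: "j \<in> I"
      have "y \<notin> nball N (r j) (p j)" if "j \<noteq> i"
        using that disj[OF i(1) j, of y] disj[OF j i(1), of y] i(2) by (metis IntD1 linear)
      then show "k j * indicat_real (nball N (r j) (p j) \<inter> X) y = (if j = i then k j else 0)"
        using i(2) by (auto simp: indicator_def)
    qed simp
    also have "\<dots> = k i" using i(1) fin by simp
    finally show ?thesis using below[OF i] i(2) by simp
  next
    case False
    then have "(\<Sum>i\<in>I. k i * indicat_real (nball N (r i) (p i) \<inter> X) y) = 0"
      by (intro sum.neutral) (auto simp: indicator_def)
    moreover have "0 \<le> indicator X y *\<^sub>R (1 / (f x\<^sub>m - f y + \<epsilon>) ^ ?n)"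
      using x\<^sub>m(2)[of y] eps by (auto simp: indicator_def)
    ultimately show ?thesis by simp
  qed
  have meas: "nball N (r i) (p i) \<inter> X \<in> lmeasurable" for i
    by (intro lmeasurable_compact compact_Int compact_nball compact)
  have "real (card I) * (\<gamma> * ball_volume N 1 * (q / (9 * L)) ^ ?n)
      = (\<Sum>i\<in>I. \<gamma> * ball_volume N 1 * (q / (9 * L)) ^ ?n)" by simp
  also have "\<dots> \<le> (\<Sum>i\<in>I. k i * measure lebesgue (nball N (r i) (p i) \<inter> X))"
  proof (rule sum_mono)
    fix i assume i: "i \<in> I"
    have "L * r i < L * r\<^sub>0" using r_le[of i] small[OF i] by simp
    then have "r i < r\<^sub>0" using L_pos by simp
    then have "\<gamma> * (r i ^ ?n * ball_volume N 1) \<le> measure lebesgue (nball N (r i) (p i) \<inter> X)"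
      using volume[OF p[OF i] r_pos] ball_volume_scale[OF r_pos] by simp
    then have "k i * (\<gamma> * (r i ^ ?n * ball_volume N 1)) \<le> k i * measure lebesgue (nball N (r i) (p i) \<inter> X)"
      using k_pos by simp
    moreover have "q / (9 * L) = r i / (9 / 4 * m i)"
      using m_pos[of i] L_pos by (simp add: r_def)
    then have "k i * r i ^ ?n = (q / (9 * L)) ^ ?n"
      by (simp only: k_def) (simp add: power_divide)
    then have "k i * (\<gamma> * (r i ^ ?n * ball_volume N 1)) = \<gamma> * ball_volume N 1 * (q / (9 * L)) ^ ?n"
      by (metis mult.assoc mult.commute)
    ultimately show "\<gamma> * ball_volume N 1 * (q / (9 * L)) ^ ?n
        \<le> k i * measure lebesgue (nball N (r i) (p i) \<inter> X)"
      by simp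
  qed
  also have "\<dots> = (LINT y|lebesgue. (\<Sum>i\<in>I. k i * indicat_real (nball N (r i) (p i) \<inter> X) y))"
    by (rule integral_weighted_indicators(2)[OF meas, symmetric])
  also have "\<dots> \<le> gap_integral f x\<^sub>m \<epsilon>"
    unfolding gap_integral_def set_lebesgue_integral_def
    by (rule integral_mono[OF integral_weighted_indicators(1)[OF meas]
          gap_integrable[unfolded set_integrable_def] pointwise])
  finally show ?thesis
    using ball_volume_pos gamma q L_pos by (simp add: field_simps power_divide)
qed

text \<open>
  Let \<open>r i\<close> be the gap of \<open>p i\<close> plus \<open>\<epsilon>\<close>, divided by \<open>L\<close>. Within distance \<open>r i\<close> of \<open>p i\<close>, the function \<open>f\<close>
  grows by at most \<open>Lip f * r i\<close>, so of \<open>L * r i = gap (p i) + \<epsilon>\<close> at least \<open>(L - Lip f) * r i\<close> is left. The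
  integrand is thus at most the inverse of \<open>((1 - Lip f / L) * L)\<^sup>d * (r i)\<^sup>d\<close> there, and \<open>r i\<close> cancels
  against the volume of the ball.
\<close>

lemma gap_integral_le_card_cover:
  fixes p :: "'i \<Rightarrow> real ^ 'd"
  assumes lip: "is_lipschitz N X f" "Lip N X f < L"
    and fin: "finite I" and p: "\<And>i. i \<in> I \<Longrightarrow> p i \<in> X"
    and cover: "\<And>x. x \<in> X \<Longrightarrow> \<exists>i\<in>I. L * N (x - p i) \<le> f x\<^sub>m - f (p i) + \<epsilon>"
  shows "((1 - Lip N X f / L) * L) ^ CARD('d) / ball_volume N 1 * gap_integral f x\<^sub>m \<epsilon> \<le> real (card I)"
proof -
  let ?n = "CARD('d)" and ?c = "1 - Lip N X f / L"
  define r where "r i = (f x\<^sub>m - f (p i) + \<epsilon>) / L" for i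
  define k where "k i = 1 / (?c * L * r i) ^ ?n" for i
  have c_pos: "0 < ?c" using lip L_pos by simp
  have r_pos: "0 < r i" if "i \<in> I" for i
    using x\<^sub>m(2)[OF p[OF that]] eps L_pos by (simp add: r_def)
  have k_pos: "0 < k i" if "i \<in> I" for i
    using r_pos[OF that] c_pos L_pos by (simp add: k_def)
  have pointwise: "indicator X x *\<^sub>R (1 / (f x\<^sub>m - f x + \<epsilon>) ^ ?n)
      \<le> (\<Sum>i\<in>I. k i * indicat_real (nball N (r i) (p i)) x)" for x
  proof (cases "x \<in> X")
    case True
    then obtain i where i: "i \<in> I" "L * N (x - p i) \<le> f x\<^sub>m - f (p i) + \<epsilon>"
      using cover by blast
    then have N_le: "N (x - p i) \<le> r i" using L_pos by (simp add: r_def field_simps)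
    have "f x - f (p i) \<le> Lip N X f * N (x - p i)"
      using Lip_bound[OF lip(1) True p[OF i(1)]] by simp
    also have "\<dots> \<le> Lip N X f * r i" using N_le Lip_nonneg[OF lip(1)] by (rule mult_left_mono)
    finally have "f x - f (p i) \<le> Lip N X f * r i" .
    moreover have "L * r i = f x\<^sub>m - f (p i) + \<epsilon>" using L_pos by (simp add: r_def)
    moreover have "?c * L * r i = L * r i - Lip N X f * r i" using L_pos by (simp add: field_simps)
    ultimately have "?c * L * r i \<le> f x\<^sub>m - f x + \<epsilon>" by linarith
    moreover have "0 < ?c * L * r i" using r_pos[OF i(1)] c_pos L_pos by simp
    ultimately have "1 / (f x\<^sub>m - f x + \<epsilon>) ^ ?n \<le> k i * indicat_real (nball N (r i) (p i)) x"
      using N_le unfolding k_def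
      by (auto simp: nball_def intro!: divide_left_mono power_mono mult_pos_pos zero_less_power)
    also have "\<dots> \<le> (\<Sum>i\<in>I. k i * indicat_real (nball N (r i) (p i)) x)"
    proof (rule member_le_sum)
      show "0 \<le> k j * indicat_real (nball N (r j) (p j)) x" if "j \<in> I - {i}" for j
        using less_imp_le[OF k_pos[of j]] that by simp
    qed (use i fin in simp_all)
    finally show ?thesis using True by simp
  next
    case False
    then show ?thesis using less_imp_le[OF k_pos] by (simp add: sum_nonneg)
  qed
  have meas: "nball N (r i) (p i) \<in> lmeasurable" for i
    by (intro lmeasurable_compact compact_nball)
  have "gap_integral f x\<^sub>m \<epsilon> \<le> (LINT x|lebesgue. (\<Sum>i\<in>I. k i * indicat_real (nball N (r i) (p i)) x))"
    unfolding gap_integral_def set_lebesgue_integral_def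
    by (rule integral_mono[OF gap_integrable[unfolded set_integrable_def]
          integral_weighted_indicators(1)[OF meas] pointwise])
  also have "\<dots> = (\<Sum>i\<in>I. k i * measure lebesgue (nball N (r i) (p i)))"
    by (rule integral_weighted_indicators(2)[OF meas])
  also have "\<dots> = (\<Sum>i\<in>I. ball_volume N 1 / (?c * L) ^ ?n)"
  proof (rule sum.cong)
    fix i assume i: "i \<in> I"
    show "k i * measure lebesgue (nball N (r i) (p i)) = ball_volume N 1 / (?c * L) ^ ?n"
      using r_pos[OF i] by (simp add: measure_nball k_def power_mult_distrib)
  qed simp
  finally have "gap_integral f x\<^sub>m \<epsilon> \<le> real (card I) * (ball_volume N 1 / (?c * L) ^ ?n)" by simp
  moreover have "0 < (?c * L) ^ ?n" using c_pos L_pos by simp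
  ultimately show ?thesis using ball_volume_pos by (simp add: field_simps)
qed

end

lemma gap_integral_nonneg:
  assumes "\<And>x. x \<in> X \<Longrightarrow> f x \<le> f x\<^sub>m" "0 < \<epsilon>"
  shows "0 \<le> gap_integral f x\<^sub>m \<epsilon>"
  unfolding gap_integral_def set_lebesgue_integral_def
  using assms by (intro Bochner_Integration.integral_nonneg) (auto simp: indicator_def)

section \<open>The lower bound\<close>

lemma observed_cong:
  assumes "\<And>i. i < n \<Longrightarrow> g (query A (observed A f i)) = f (query A (observed A f i))"
  shows "observed A g n = observed A f n"
  using assms by (induction n) auto

text \<open>
  The function \<open>g\<close> in the proof is the largest \<open>L\<close>-Lipschitz function (McShane's extension) that agrees
  with \<open>f\<close> at the queried points and at the recommendation \<open>z\<close>. The algorithm outputs the same on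
  \<open>g\<close> as on \<open>f\<close>, so \<open>g x \<le> g z + \<epsilon> = f z + \<epsilon> \<le> f x\<^sub>m + \<epsilon>\<close> for all \<open>x\<close>. Read at the point where the minimum that
  defines \<open>g x\<close> is attained, this is the covering property. Including \<open>z\<close> among the interpolated points
  is what gives \<open>g z = f z\<close>; the recommendation need not have been queried.
\<close>

lemma certified_cover:
  assumes A: "A \<in> certified_algorithms N X L" and f: "L_lipschitz N X L f"
    and x\<^sub>m: "x\<^sub>m \<in> X" "\<And>x. x \<in> X \<Longrightarrow> f x \<le> f x\<^sub>m"
    and n: "1 \<le> n" "certificate A f n \<le> \<epsilon>"
  obtains P where "finite P" "card P \<le> n + 1" "P \<subseteq> X"
    "\<And>x. x \<in> X \<Longrightarrow> \<exists>z\<in>P. L * N (x - z) \<le> f x\<^sub>m - f z + \<epsilon>"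
proof -
  define z where "z = recommendation A f n"
  define P where "P = insert z (query_point A f ` {1..n})"
  define g where "g x = Min ((\<lambda>y. f y + L * N (x - y)) ` P)" for x
  have P: "finite P" "P \<noteq> {}" "P \<subseteq> X"
    using A n unfolding P_def z_def certified_algorithms_def by auto
  have g_le: "g x \<le> f y + L * N (x - y)" if "y \<in> P" for x y
    unfolding g_def using P that by (intro Min_le) auto
  have g_attained: "\<exists>y\<in>P. g x = f y + L * N (x - y)" for x
  proof -
    have "g x \<in> (\<lambda>y. f y + L * N (x - y)) ` P" unfolding g_def using P by (intro Min_in) auto
    then show ?thesis by blast
  qed
  have g_eq: "g y = f y" if y: "y \<in> P" for y
  proof (rule antisym)
    show "g y \<le> f y" using g_le[OF y, of y] N_eq_0[of 0] by simp
    obtain w where "w \<in> P" "g y = f w + L * N (y - w)" using g_attained by blast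
    then show "f y \<le> g y"
      using f P y by (force simp: L_lipschitz_iff abs_le_iff)
  qed
  have g_diff: "g x - g y \<le> L * N (x - y)" for x y
  proof -
    obtain w where w: "w \<in> P" "g y = f w + L * N (y - w)" using g_attained by blast
    have "L * N (x - w) \<le> L * (N (x - y) + N (y - w))"
      using N_triangle_diff L_pos by simp
    then show ?thesis using g_le[OF w(1), of x] w(2) by (simp add: distrib_left)
  qed
  then have g: "L_lipschitz N X L g"
    unfolding L_lipschitz_iff abs_le_iff by (simp add: N_commute) (metis N_commute)
  have "observed A g n = observed A f n"
  proof (rule observed_cong)
    fix i assume "i < n"
    then have "query A (observed A f i) \<in> P"
      unfolding P_def query_point_def by (intro insertI2 image_eqI[where x = "Suc i"]) auto
    then show "g (query A (observed A f i)) = f (query A (observed A f i))" by (rule g_eq)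
  qed
  then have "(SUP x\<in>X. g x) - g z \<le> \<epsilon>"
    using A g n unfolding certified_algorithms_def z_def recommendation_def certificate_def
    by fastforce
  moreover have "z \<in> P" by (simp add: P_def)
  moreover have "g x \<le> (SUP x\<in>X. g x)" if "x \<in> X" for x
    using that L_lipschitz_bdd_above[OF g] by (rule cSUP_upper)
  ultimately have g_bound: "g x \<le> f x\<^sub>m + \<epsilon>" if "x \<in> X" for x
    using that g_eq[of z] x\<^sub>m(2)[of z] P(3) by fastforce
  then have cover: "\<exists>z\<in>P. L * N (x - z) \<le> f x\<^sub>m - f z + \<epsilon>" if "x \<in> X" for x
  proof -
    obtain y where "y \<in> P" "g x = f y + L * N (x - y)" using g_attained by blast
    moreover have "g x \<le> f x\<^sub>m + \<epsilon>" using that by (rule g_bound)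
    ultimately show ?thesis by (intro bexI[of _ y]) auto
  qed
  have "card (query_point A f ` {1..n}) \<le> n" using card_image_le[of "{1..n}"] by simp
  then have "card P \<le> n + 1"
    unfolding P_def by (intro order.trans[OF card_insert_le_m1]) auto
  then show ?thesis using P cover by (intro that)
qed

lemma certified_lower_bound:
  assumes A: "A \<in> certified_algorithms N X L" and f: "is_lipschitz N X f" "Lip N X f < L"
    and x\<^sub>m: "x\<^sub>m \<in> X" "\<And>x. x \<in> X \<Longrightarrow> f x \<le> f x\<^sub>m" and eps: "0 < \<epsilon>"
    and n: "1 \<le> n" "certificate A f n \<le> \<epsilon>"
  shows "((1 - Lip N X f / L) * L) ^ CARD('d) / (2 * ball_volume N 1) * gap_integral f x\<^sub>m \<epsilon> \<le> real n"
proof -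
  have lip: "L_lipschitz N X L f" using f by (simp add: L_lipschitz_def)
  obtain P where P: "finite P" "card P \<le> n + 1" "P \<subseteq> X"
    "\<And>x. x \<in> X \<Longrightarrow> \<exists>z\<in>P. L * N (x - z) \<le> f x\<^sub>m - f z + \<epsilon>"
    using certified_cover[OF A lip x\<^sub>m n] by blast
  have "((1 - Lip N X f / L) * L) ^ CARD('d) / ball_volume N 1 * gap_integral f x\<^sub>m \<epsilon> \<le> real (card P)"
    using P by (intro gap_integral_le_card_cover[OF lip x\<^sub>m eps f, where p = id]) auto
  \<comment> \<open>The point in excess of the queries is the recommendation.\<close>
  also have "\<dots> \<le> 2 * real n" using P(2) n(1) by simp
  finally show ?thesis by simp
qed

end

section \<open>The invariant of c.DOO\<close>

lemma selection_rule_arg_max: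
  fixes u :: "nat \<times> nat \<Rightarrow> real"
  assumes "selection_rule s" "finite M" "M \<noteq> {}"
  shows "s ys {c. is_arg_max u (\<lambda>c. c \<in> M) c} \<in> M"
    and "c \<in> M \<Longrightarrow> u c \<le> u (s ys {c. is_arg_max u (\<lambda>c. c \<in> M) c})"
proof -
  have "Max (u ` M) \<in> u ` M" using assms by (intro Max_in) auto
  then obtain b where "b \<in> M" "u b = Max (u ` M)" by (metis imageE)
  then have "is_arg_max u (\<lambda>c. c \<in> M) b" using assms(2) by (simp add: is_arg_max_linorder)
  then have "is_arg_max u (\<lambda>c. c \<in> M) (s ys {c. is_arg_max u (\<lambda>c. c \<in> M) c})"
    using assms(1)[unfolded selection_rule_def, rule_format, of "{c. is_arg_max u (\<lambda>c. c \<in> M) c}"]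
    by blast
  then show "s ys {c. is_arg_max u (\<lambda>c. c \<in> M) c} \<in> M"
    and "c \<in> M \<Longrightarrow> u c \<le> u (s ys {c. is_arg_max u (\<lambda>c. c \<in> M) c})"
    unfolding is_arg_max_linorder by blast+
qed

locale doo = lipschitz_domain N X L
  for N :: "real ^ 'd \<Rightarrow> real" and X :: "(real ^ 'd) set" and L :: real +
  fixes \<delta> R \<nu> :: real and K :: nat
    and C :: "nat \<Rightarrow> nat \<Rightarrow> (real ^ 'd) set"
    and ch :: "nat \<Rightarrow> nat \<Rightarrow> nat list"
    and rep :: "nat \<Rightarrow> nat \<Rightarrow> real ^ 'd"
    and tie pick :: "real list \<Rightarrow> (nat \<times> nat) set \<Rightarrow> nat \<times> nat"
  assumes cells: "cell_hierarchy X K C ch rep"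
    and D1: "cond_D1 N K C \<delta> R"
    and D2: "cond_D2 N K rep \<delta> \<nu>"
    and tie: "selection_rule tie" and pick: "selection_rule pick"
begin

abbreviation cell :: "nat \<times> nat \<Rightarrow> (real ^ 'd) set" where
  "cell c \<equiv> C (fst c) (snd c)"

abbreviation point :: "nat \<times> nat \<Rightarrow> real ^ 'd" where
  "point c \<equiv> rep (fst c) (snd c)"

text \<open>Only such cells are ever queried: their representatives lie in the domain.\<close>

definition relevant :: "nat \<times> nat \<Rightarrow> bool" where
  "relevant c \<longleftrightarrow> snd c < K ^ fst c \<and> cell c \<inter> X \<noteq> {}"

definition children :: "nat \<times> nat \<Rightarrow> (nat \<times> nat) set" where
  "children c = Pair (Suc (fst c)) ` set (ch (fst c) (snd c))"

lemma cells_cover: "X \<subseteq> (\<Union>i<K ^ h. C h i)"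
  and cells_disjoint: "disjoint_family_on (C h) {..<K ^ h}"
  using cells unfolding cell_hierarchy_def by blast+

lemma
  assumes "i < K ^ h"
  shows rep_in_cell: "rep h i \<in> C h i"
    and rep_in_X: "C h i \<inter> X \<noteq> {} \<Longrightarrow> rep h i \<in> X"
    and ch_distinct: "distinct (ch h i)" and ch_length: "length (ch h i) = K"
    and ch_bound: "set (ch h i) \<subseteq> {..<K ^ Suc h}"
    and ch_Union: "(\<Union>j\<in>set (ch h i). C (Suc h) j) = C h i"
  using cells assms unfolding cell_hierarchy_def by blast+

lemma relevant_point: "relevant c \<Longrightarrow> point c \<in> X"
  using rep_in_X by (auto simp: relevant_def)

lemma relevant_root: "relevant (0, 0)" and X_subset_root: "X \<subseteq> C 0 0"
  using cells_cover[of 0] nonempty by (auto simp: relevant_def)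

lemma radius_pos: "0 < R" and ratio_pos: "0 < \<delta>"
  using D1 by (auto simp: cond_D1_def)

lemma cell_diameter: "i < K ^ h \<Longrightarrow> u \<in> C h i \<Longrightarrow> v \<in> C h i \<Longrightarrow> N (u - v) \<le> R * \<delta> ^ h"
  using D1 unfolding cond_D1_def by blast

lemma rep_separation:
  "i < K ^ h \<Longrightarrow> i' < K ^ h' \<Longrightarrow> (h, i) \<noteq> (h', i') \<Longrightarrow>
     \<nu> * \<delta> ^ max h h' \<le> N (rep h i - rep h' i')"
  using D2 unfolding cond_D2_def by blast

lemma cell_upper_bound:
  assumes "L_lipschitz N X L f" "relevant c" "x \<in> X" "x \<in> cell c"
  shows "f x \<le> f (point c) + L * R * \<delta> ^ fst c"
proof -
  have "N (x - point c) \<le> R * \<delta> ^ fst c"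
    using cell_diameter[OF _ assms(4) rep_in_cell] assms(2) by (simp add: relevant_def)
  then have "L * N (x - point c) \<le> L * (R * \<delta> ^ fst c)" using L_pos by simp
  moreover have "f x - f (point c) \<le> L * N (x - point c)"
    using assms relevant_point by (force simp: L_lipschitz_iff abs_le_iff)
  ultimately show ?thesis by simp
qed

text \<open>
  Children are non-empty subsets of their parent, and distinct cells of equal depth are disjoint.
\<close>

lemma parent_unique:
  assumes "relevant b" "relevant c" "d \<in> children b" "d \<in> children c"
  shows "b = c"
proof (rule prod_eqI)
  show h: "fst b = fst c" using assms(3,4) by (auto simp: children_def)
  have b: "snd b < K ^ fst b" and c: "snd c < K ^ fst b" using assms h by (simp_all add: relevant_def)
  have "cell d \<subseteq> cell b" "cell d \<subseteq> cell c"
    using ch_Union[OF b] ch_Union[OF c] assms(3,4) h by (auto simp: children_def)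
  moreover have "snd d < K ^ fst d" using ch_bound[OF b] assms(3) by (auto simp: children_def)
  then have "cell d \<noteq> {}" using rep_in_cell by blast
  ultimately have "C (fst b) (snd b) \<inter> C (fst b) (snd c) \<noteq> {}" using h by auto
  then show "snd b = snd c"
    using cells_disjoint[of "fst b"] b c by (auto simp: disjoint_family_on_def)
qed

abbreviation alg :: "(real ^ 'd) algorithm" where
  "alg \<equiv> cDOO X L R \<delta> C ch rep tie pick"

abbreviation ready :: "doo_state \<Rightarrow> doo_state" where
  "ready \<equiv> doo_ready X L R \<delta> C ch tie"

definition run :: "(real ^ 'd \<Rightarrow> real) \<Rightarrow> nat \<Rightarrow> doo_state" where
  "run f n = doo_after X L R \<delta> C ch tie (observed alg f n)"

definition seen :: "doo_state \<Rightarrow> (nat \<times> nat) set" where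
  "seen s = fst ` set (evals s)"

text \<open>
  A cell remains among the leaves while it is being expanded. Hence the cells that have been chosen
  for expansion can be read off from a state: they are the evaluated cells that are leaves no longer,
  and the one in progress.
\<close>

definition expanded :: "doo_state \<Rightarrow> (nat \<times> nat) set" where
  "expanded s = (seen s - leaves s) \<union> set_option (expanding s)"

definition evaluate_next :: "(real ^ 'd \<Rightarrow> real) \<Rightarrow> doo_state \<Rightarrow> doo_state" where
  "evaluate_next f s =
     s\<lparr>leaves := insert (hd (todo s)) (leaves s), todo := tl (todo s),
       evals := evals s @ [(hd (todo s), f (point (hd (todo s))))]\<rparr>"

lemma run_0: "run f 0 = doo_init"
  by (simp add: run_def doo_after_def)

lemma query_alg: "query alg (observed alg f n) = point (hd (todo (ready (run f n))))"
  by (simp add: cDOO_def run_def case_prod_unfold)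

lemma certificate_alg: "certificate alg f n = doo_certificate L R \<delta> pick (run f n)"
proof -
  have "certify alg ys = doo_certificate L R \<delta> pick (doo_after X L R \<delta> C ch tie ys)" for ys
    by (simp add: cDOO_def)
  then show ?thesis by (simp only: certificate_def run_def)
qed

lemma recommendation_alg: "recommendation alg f n = point (incumbent pick (run f n))"
proof -
  have "recommend alg ys = point (incumbent pick (doo_after X L R \<delta> C ch tie ys))" for ys
    by (simp add: cDOO_def case_prod_unfold)
  then show ?thesis by (simp only: recommendation_def run_def)
qed

lemma run_Suc: "run f (Suc n) = evaluate_next f (ready (run f n))"
  using query_alg[of f n]
  by (simp add: run_def doo_after_def doo_observe_def evaluate_next_def Let_def)

lemma length_evals_run: "length (evals (run f n)) = n"
  by (induction n)
     (auto simp: run_0 doo_init_def run_Suc evaluate_next_def doo_ready_def next_iteration_def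
        Let_def case_prod_unfold)

text \<open>
  The covering clause omits the cell being expanded: its part of \<open>X\<close> is covered by the children,
  each of which is either a leaf already or still to be queried. The parent clause serves to show that
  the children of a newly chosen cell have not been evaluated before, which keeps \<open>expanded\<close> from losing
  cells and the count of queries correct. The bound by the upper value of an expanded cell mentions
  \<open>f\<close> and representatives only, and so persists after the iteration that established it.
\<close>

definition invariant :: "(real ^ 'd \<Rightarrow> real) \<Rightarrow> doo_state \<Rightarrow> bool" where
  "invariant f s \<longleftrightarrow>
     (\<forall>c\<in>seen s \<union> set (todo s).
        relevant c \<and> (c = (0, 0) \<or> (\<exists>b\<in>expanded s. c \<in> children b))) \<and>
     (\<forall>(c, y)\<in>set (evals s). y = f (point c)) \<and>
     leaves s \<subseteq> seen s \<and> set_option (expanding s) \<subseteq> leaves s \<and>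
     X \<subseteq> \<Union> (cell ` (leaves s - set_option (expanding s) \<union> set (todo s))) \<and>
     distinct (todo s) \<and> seen s \<inter> set (todo s) = {} \<and>
     length (evals s) + length (todo s) \<le> 1 + K * card (expanded s) \<and>
     (L_lipschitz N X L f \<longrightarrow>
        (\<forall>c\<in>expanded s. \<forall>x\<in>X. f x \<le> f (point c) + L * R * \<delta> ^ fst c))"

lemma finite_seen: "finite (seen s)"
  by (simp add: seen_def)

lemma expanded_subset_seen: "invariant f s \<Longrightarrow> expanded s \<subseteq> seen s"
  by (auto simp: invariant_def expanded_def)

lemma finite_expanded: "finite (expanded s)"
  by (cases "expanding s") (auto simp: expanded_def finite_seen)

lemma cell_value_eq:
  assumes "invariant f s" "c \<in> seen s"
  shows "cell_value s c = f (point c)"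
proof -
  obtain y where "map_of (evals s) c = Some y"
    using assms(2) by (cases "map_of (evals s) c") (auto simp: seen_def map_of_eq_None_iff)
  moreover from map_of_SomeD[OF this] have "y = f (point c)"
    using assms(1) by (auto simp: invariant_def)
  ultimately show ?thesis by (simp add: cell_value_def)
qed

lemma invariant_init: "invariant f doo_init"
  using relevant_root X_subset_root
  by (auto simp: invariant_def doo_init_def seen_def expanded_def)

lemma next_iteration_cases:
  assumes inv: "invariant f s" and empty: "todo s = []"
  obtains c where "c \<in> leaves s - set_option (expanding s)"
    "\<And>b. b \<in> leaves s - set_option (expanding s) \<Longrightarrow>
       f (point b) + L * R * \<delta> ^ fst b \<le> f (point c) + L * R * \<delta> ^ fst c"
    "ready s = s\<lparr>leaves := leaves s - set_option (expanding s), expanding := Some c,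
       todo := map (Pair (Suc (fst c)))
         (filter (\<lambda>j. C (Suc (fst c)) j \<inter> X \<noteq> {}) (ch (fst c) (snd c)))\<rparr>"
proof -
  define M where "M = leaves s - set_option (expanding s)"
  define c where "c = tie (map snd (evals s)) {c. is_arg_max (upper_value L R \<delta> s) (\<lambda>c. c \<in> M) c}"
  have M: "M \<subseteq> seen s" "X \<subseteq> \<Union> (cell ` M)"
    using inv empty by (auto simp: invariant_def M_def)
  then have "finite M" "M \<noteq> {}" using nonempty finite_subset[OF _ finite_seen] by auto
  note c = selection_rule_arg_max[OF tie this, where ys = "map snd (evals s)" and u = "upper_value L R \<delta> s",
      folded c_def]
  show ?thesis
  proof (rule that)
    show "c \<in> leaves s - set_option (expanding s)" using c(1) by (simp add: M_def)
    show "f (point b) + L * R * \<delta> ^ fst b \<le> f (point c) + L * R * \<delta> ^ fst c"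
      if "b \<in> leaves s - set_option (expanding s)" for b
    proof -
      have "b \<in> M" using that by (simp add: M_def)
      then have "b \<in> seen s" "c \<in> seen s" using c(1) M(1) by blast+
      then show ?thesis
        using c(2)[OF \<open>b \<in> M\<close>] by (simp add: upper_value_def cell_value_eq[OF inv])
    qed
    show "ready s = s\<lparr>leaves := leaves s - set_option (expanding s), expanding := Some c,
       todo := map (Pair (Suc (fst c)))
         (filter (\<lambda>j. C (Suc (fst c)) j \<inter> X \<noteq> {}) (ch (fst c) (snd c)))\<rparr>"
      using empty by (simp add: doo_ready_def next_iteration_def Let_def case_prod_unfold c_def M_def)
  qed
qed

text \<open>
  The heart of the matter is the choice of a cell \<open>c\<close> of largest upper value. Any \<open>x\<close> lies in one of
  the cells \<open>b\<close> among which the choice is made, so \<open>f x\<close> is at most the upper value of \<open>b\<close>, hence at most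
  that of \<open>c\<close>. Some child of \<open>c\<close> meets \<open>X\<close>, as \<open>c\<close> does, so there is always a next query.
\<close>

lemma invariant_ready:
  assumes inv: "invariant f s"
  shows "invariant f (ready s)" "todo (ready s) \<noteq> []"
    "expanded (ready s) \<subseteq> expanded s \<union> set_option (expanding (ready s))"
proof -
  have "invariant f (ready s) \<and> todo (ready s) \<noteq> [] \<and>
    expanded (ready s) \<subseteq> expanded s \<union> set_option (expanding (ready s))"
  proof (cases "todo s = []")
    case False
    then show ?thesis using inv by (simp add: doo_ready_def)
  next
    case True
    define M where "M = leaves s - set_option (expanding s)"
    obtain c where c: "c \<in> M"
      "\<And>b. b \<in> M \<Longrightarrow> f (point b) + L * R * \<delta> ^ fst b \<le> f (point c) + L * R * \<delta> ^ fst c"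
      and ready: "ready s = s\<lparr>leaves := M, expanding := Some c,
       todo := map (Pair (Suc (fst c)))
         (filter (\<lambda>j. C (Suc (fst c)) j \<inter> X \<noteq> {}) (ch (fst c) (snd c)))\<rparr>"
      using next_iteration_cases[OF inv True] unfolding M_def by blast
    have M_seen: "M \<subseteq> seen s" and M_cover: "X \<subseteq> \<Union> (cell ` M)"
      using inv True by (auto simp: invariant_def M_def)
    have seen: "seen (ready s) = seen s" by (simp add: seen_def ready)
    have c_seen: "c \<in> seen s" using c(1) M_seen by blast
    then have c_rel: "relevant c" using inv by (simp add: invariant_def)
    then have c_idx: "snd c < K ^ fst c" by (simp add: relevant_def)
    have new: "c \<notin> expanded s" using c(1) by (auto simp: expanded_def M_def)
    have expanded: "expanded (ready s) = insert c (expanded s)"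
      using inv unfolding expanded_def seen by (auto simp: ready M_def invariant_def)
    have todo: "set (todo (ready s)) = {d \<in> children c. relevant d}"
      using ch_bound[OF c_idx] by (auto simp: ready children_def relevant_def image_iff)
    have children_cover: "\<exists>d\<in>set (todo (ready s)). x \<in> cell d" if x: "x \<in> X" "x \<in> cell c" for x
    proof -
      obtain j where "j \<in> set (ch (fst c) (snd c))" "x \<in> C (Suc (fst c)) j"
        using ch_Union[OF c_idx] x(2) by blast
      then show ?thesis
        using x(1) by (intro bexI[of _ "(Suc (fst c), j)"]) (auto simp: ready)
    qed
    \<comment> \<open>A child of \<open>c\<close> seen earlier would have an expanded parent, but that parent is \<open>c\<close>.\<close>
    have fresh: "seen s \<inter> set (todo (ready s)) = {}"
    proof (rule ccontr)
      assume "seen s \<inter> set (todo (ready s)) \<noteq> {}"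
      then obtain d where d: "d \<in> seen s" "d \<in> children c" using todo by auto
      then have "d \<noteq> (0, 0)" by (auto simp: children_def)
      then obtain b where b: "b \<in> expanded s" "d \<in> children b"
        using inv d(1) by (auto simp: invariant_def)
      then have "relevant b"
        using inv expanded_subset_seen[OF inv] by (auto simp: invariant_def)
      then show False using parent_unique[OF _ c_rel b(2) d(2)] b(1) new by simp
    qed
    have "length (todo (ready s)) \<le> K"
      using ch_length[OF c_idx] length_filter_le[of _ "ch (fst c) (snd c)"] by (simp add: ready)
    moreover have "card (expanded (ready s)) = Suc (card (expanded s))"
      using expanded new finite_expanded by simp
    moreover have "length (evals s) \<le> 1 + K * card (expanded s)" using inv True by (simp add: invariant_def)
    ultimately have count: "length (evals (ready s)) + length (todo (ready s)) \<le> 1 + K * card (expanded (ready s))"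
      by (simp add: ready)
    have "invariant f (ready s)"
      unfolding invariant_def
    proof (intro conjI)
      show "\<forall>d\<in>seen (ready s) \<union> set (todo (ready s)).
          relevant d \<and> (d = (0, 0) \<or> (\<exists>b\<in>expanded (ready s). d \<in> children b))"
        using inv unfolding seen expanded todo by (auto simp: invariant_def)
      show "\<forall>(c, y)\<in>set (evals (ready s)). y = f (point c)"
        using inv by (simp add: ready invariant_def)
      show "leaves (ready s) \<subseteq> seen (ready s)" using M_seen unfolding seen by (simp add: ready)
      show "set_option (expanding (ready s)) \<subseteq> leaves (ready s)" using c(1) by (simp add: ready)
      show "X \<subseteq> \<Union> (cell ` (leaves (ready s) - set_option (expanding (ready s)) \<union> set (todo (ready s))))"
      proof
        fix x assume x: "x \<in> X"
        then obtain b where "b \<in> M" "x \<in> cell b" using M_cover by blast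
        then show "x \<in> \<Union> (cell ` (leaves (ready s) - set_option (expanding (ready s)) \<union> set (todo (ready s))))"
          using children_cover[OF x] by (cases "b = c") (auto simp: ready)
      qed
      show "distinct (todo (ready s))"
        using ch_distinct[OF c_idx] by (auto simp: ready distinct_map inj_on_def)
      show "seen (ready s) \<inter> set (todo (ready s)) = {}" using fresh seen by simp
      show "length (evals (ready s)) + length (todo (ready s)) \<le> 1 + K * card (expanded (ready s))"
        by (rule count)
      show "L_lipschitz N X L f \<longrightarrow>
        (\<forall>c\<in>expanded (ready s). \<forall>x\<in>X. f x \<le> f (point c) + L * R * \<delta> ^ fst c)"
      proof
        assume f: "L_lipschitz N X L f"
        have "f x \<le> f (point c) + L * R * \<delta> ^ fst c" if x: "x \<in> X" for x
        proof -
          obtain b where b: "b \<in> M" "x \<in> cell b" using M_cover x by blast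
          then have "relevant b" using inv M_seen by (auto simp: invariant_def)
          then show ?thesis using cell_upper_bound[OF f _ x b(2)] c(2)[OF b(1)] by simp
        qed
        then show "\<forall>c\<in>expanded (ready s). \<forall>x\<in>X. f x \<le> f (point c) + L * R * \<delta> ^ fst c"
          using inv f unfolding expanded by (simp add: invariant_def)
      qed
    qed
    moreover have "todo (ready s) \<noteq> []"
      using c_rel children_cover unfolding relevant_def by fastforce
    ultimately show ?thesis using expanded by (simp add: ready)
  qed
  then show "invariant f (ready s)" "todo (ready s) \<noteq> []"
    "expanded (ready s) \<subseteq> expanded s \<union> set_option (expanding (ready s))" by blast+
qed

lemma invariant_evaluate_next:
  assumes inv: "invariant f s" and "todo s \<noteq> []"
  shows "invariant f (evaluate_next f s)" "expanded (evaluate_next f s) = expanded s"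
proof -
  obtain c cs where todo: "todo s = c # cs" using assms(2) by (cases "todo s") auto
  let ?s = "evaluate_next f s"
  have s: "?s = s\<lparr>leaves := insert c (leaves s), todo := cs, evals := evals s @ [(c, f (point c))]\<rparr>"
    by (simp add: evaluate_next_def todo)
  have seen: "seen ?s = insert c (seen s)" by (simp add: seen_def s)
  have c: "c \<notin> seen s" "c \<notin> set cs" using inv by (auto simp: invariant_def todo)
  show expanded: "expanded ?s = expanded s"
    using c(1) unfolding expanded_def seen by (auto simp: s)
  have not_expanding: "c \<notin> set_option (expanding s)" using inv c(1) by (auto simp: invariant_def)
  then have open_cells: "leaves ?s - set_option (expanding ?s) \<union> set (todo ?s)
      = leaves s - set_option (expanding s) \<union> set (todo s)"
    by (auto simp: s todo)
  show "invariant f ?s"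
    unfolding invariant_def expanded seen open_cells
  proof (intro conjI)
    show "distinct (todo ?s)" "insert c (seen s) \<inter> set (todo ?s) = {}"
      using inv c by (auto simp: invariant_def s todo)
    show "leaves ?s \<subseteq> insert c (seen s)" "set_option (expanding ?s) \<subseteq> leaves ?s"
      using inv by (auto simp: invariant_def s)
  qed (use inv in \<open>simp_all add: invariant_def s todo\<close>)
qed

lemma invariant_run: "invariant f (run f n)"
  by (induction n) (simp_all add: run_0 invariant_init run_Suc invariant_evaluate_next invariant_ready)

lemma expanded_run_Suc:
  "expanded (run f (Suc n)) \<subseteq> expanded (run f n) \<union> set_option (expanding (run f (Suc n)))"
proof -
  have "expanding (run f (Suc n)) = expanding (ready (run f n))"
    by (simp add: run_Suc evaluate_next_def)
  moreover have "expanded (run f (Suc n)) = expanded (ready (run f n))"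
    unfolding run_Suc by (rule invariant_evaluate_next(2)[OF invariant_ready(1,2)[OF invariant_run]])
  ultimately show ?thesis using invariant_ready(3)[OF invariant_run] by simp
qed

lemma incumbent_run:
  assumes "1 \<le> n"
  shows "incumbent pick (run f n) \<in> seen (run f n)"
    and "c \<in> seen (run f n) \<Longrightarrow> f (point c) \<le> f (point (incumbent pick (run f n)))"
proof -
  let ?s = "run f n"
  have "seen ?s \<noteq> {}" using length_evals_run[of f n] assms by (auto simp: seen_def)
  note * = selection_rule_arg_max[OF pick finite_seen this,
      where ys = "map snd (evals ?s)" and u = "cell_value ?s"]
  show inc: "incumbent pick ?s \<in> seen ?s"
    using *(1) by (simp add: incumbent_def seen_def)
  show "f (point c) \<le> f (point (incumbent pick ?s))" if "c \<in> seen ?s"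
    using *(2)[OF that] cell_value_eq[OF invariant_run inc] cell_value_eq[OF invariant_run that]
    by (simp add: incumbent_def seen_def)
qed

lemma seen_run_relevant: "c \<in> seen (run f n) \<Longrightarrow> relevant c"
  using invariant_run[of f n] by (simp add: invariant_def)

lemma certificate_None:
  "expanding (run f n) = None \<Longrightarrow> certificate alg f n = L * R"
  by (simp add: certificate_alg doo_certificate_def)

lemma certificate_Some:
  assumes "1 \<le> n" "expanding (run f n) = Some c"
  shows "certificate alg f n
    = f (point c) + L * R * \<delta> ^ fst c - f (point (incumbent pick (run f n)))"
proof -
  have "c \<in> seen (run f n)" 
    using assms(2) expanded_subset_seen[OF invariant_run, of f n] by (auto simp: expanded_def)
  then show ?thesis
    using assms(2) cell_value_eq[OF invariant_run] incumbent_run(1)[OF assms(1)]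
    by (simp add: certificate_alg doo_certificate_def upper_value_def)
qed

section \<open>Correctness of the certificates of c.DOO\<close>

lemma alg_certified: "alg \<in> certified_algorithms N X L"
proof -
  have query: "query_point alg f n \<in> X" for f n
  proof -
    define s where "s = ready (run f (n - 1))"
    have "invariant f s" "todo s \<noteq> []"
      using invariant_ready[OF invariant_run] by (simp_all add: s_def)
    then have "relevant (hd (todo s))" by (simp add: invariant_def)
    then show ?thesis unfolding query_point_def query_alg s_def[symmetric] by (rule relevant_point)
  qed
  have rec_X: "recommendation alg f n \<in> X" if "1 \<le> n" for f n
    unfolding recommendation_alg
    using relevant_point[OF seen_run_relevant[OF incumbent_run(1)[OF that]]] .
  have cert: "f x - f (recommendation alg f n) \<le> certificate alg f n"
    if f: "L_lipschitz N X L f" and n: "1 \<le> n" and x: "x \<in> X" for f n x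
  proof (cases "expanding (run f n)")
    case None
    have "N (x - recommendation alg f n) \<le> R"
      using cell_diameter[of 0 0 x "recommendation alg f n"] X_subset_root x rec_X[OF n] by auto
    then have "L * N (x - recommendation alg f n) \<le> L * R" using L_pos by simp
    moreover have "f x - f (recommendation alg f n) \<le> L * N (x - recommendation alg f n)"
      using f x rec_X[OF n] by (force simp: L_lipschitz_iff abs_le_iff)
    ultimately show ?thesis using certificate_None[OF None] by simp
  next
    case (Some c)
    have "f x \<le> f (point c) + L * R * \<delta> ^ fst c"
      using invariant_run[of f n] f x Some unfolding invariant_def expanded_def by auto
    then show ?thesis using certificate_Some[OF n Some] by (simp add: recommendation_alg)
  qed
  have "0 \<le> certificate alg f n" "(SUP x\<in>X. f x) - f (recommendation alg f n) \<le> certificate alg f n"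
    if f: "L_lipschitz N X L f" and n: "1 \<le> n" for f n
  proof -
    show "0 \<le> certificate alg f n" using cert[OF f n rec_X[OF n, of f]] by simp
    have "(SUP x\<in>X. f x) \<le> certificate alg f n + f (recommendation alg f n)"
    proof (rule cSUP_least[OF nonempty])
      fix x assume "x \<in> X"
      from cert[OF f n this] show "f x \<le> certificate alg f n + f (recommendation alg f n)" by simp
    qed
    then show "(SUP x\<in>X. f x) - f (recommendation alg f n) \<le> certificate alg f n" by simp
  qed
  then show ?thesis unfolding certified_algorithms_def using query rec_X by blast
qed

section \<open>The upper bound\<close>

text \<open>
  The incumbent is at least as good as the representative of the cell being expanded, so the
  certificate is at most the diameter term \<open>L * R * \<delta> ^ h\<close> of that cell.
\<close>

lemma expanded_depth:
  assumes "\<And>m. 1 \<le> m \<Longrightarrow> m \<le> n \<Longrightarrow> \<epsilon> < certificate alg f m" "c \<in> expanded (run f n)"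
  shows "\<epsilon> < L * R * \<delta> ^ fst c"
  using assms
proof (induction n)
  case 0
  then show ?case by (simp add: run_0 doo_init_def expanded_def seen_def)
next
  case (Suc n)
  show ?case
  proof (cases "c \<in> expanded (run f n)")
    case True
    then show ?thesis using Suc by simp
  next
    case False
    then have exp: "expanding (run f (Suc n)) = Some c"
      using Suc.prems(2) expanded_run_Suc[of f n] by auto
    have "c \<in> seen (run f (Suc n))"
      using Suc.prems(2) expanded_subset_seen[OF invariant_run] by blast
    then have "certificate alg f (Suc n) \<le> L * R * \<delta> ^ fst c"
      using incumbent_run(2)[of "Suc n" c f] certificate_Some[OF _ exp] by simp
    then show ?thesis using Suc.prems(1)[of "Suc n"] by simp
  qed
qed

text \<open>
  While the certificates exceed \<open>\<epsilon>\<close>, for an expanded cell \<open>c\<close> of depth \<open>h\<close> the quantity \<open>m c\<close>, the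
  maximum of \<open>\<epsilon>\<close> and of the gap at the representative, is at most \<open>L * R * \<delta> ^ h\<close>. For two cells, the
  separation \<open>\<nu> * \<delta> ^ max h h'\<close> is governed by the deeper one, hence is at least \<open>\<nu> / (L * R)\<close> times the smaller of the two values of \<open>m\<close>.
\<close>

lemma card_expanded_le:
  fixes r\<^sub>0 \<gamma> \<epsilon> :: real
  defines "q \<equiv> min (\<nu> / R) 1"
  assumes f: "L_lipschitz N X L f" and x\<^sub>m: "x\<^sub>m \<in> X" "\<And>x. x \<in> X \<Longrightarrow> f x \<le> f x\<^sub>m"
    and eps: "0 < \<epsilon>" "\<epsilon> < 4 * L * r\<^sub>0"
    and diam: "\<And>x y. x \<in> X \<Longrightarrow> y \<in> X \<Longrightarrow> L * N (x - y) < 4 * L * r\<^sub>0"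
    and gamma: "0 < \<gamma>"
    and volume: "\<And>x r. x \<in> X \<Longrightarrow> 0 < r \<Longrightarrow> r < r\<^sub>0 \<Longrightarrow>
                   \<gamma> * ball_volume N r \<le> measure lebesgue (nball N r x \<inter> X)"
    and cert: "\<And>m. 1 \<le> m \<Longrightarrow> m \<le> n \<Longrightarrow> \<epsilon> < certificate alg f m"
  shows "real (card (expanded (run f n)))
    \<le> (9 * L / q) ^ CARD('d) / (ball_volume N 1 * \<gamma>) * gap_integral f x\<^sub>m \<epsilon>"
proof -
  let ?E = "expanded (run f n)"
  define m where "m c = max (f x\<^sub>m - f (point c)) \<epsilon>" for c
  have nu: "0 < \<nu>" using D2 by (simp add: cond_D2_def)
  then have q: "0 < q" "q \<le> 1" using radius_pos by (simp_all add: q_def)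
  have rel: "relevant c" if "c \<in> ?E" for c
    using that expanded_subset_seen[OF invariant_run] seen_run_relevant by blast
  have m_le: "m c \<le> L * R * \<delta> ^ fst c" if "c \<in> ?E" for c
  proof -
    have "f x\<^sub>m \<le> f (point c) + L * R * \<delta> ^ fst c"
      using invariant_run[of f n] f that x\<^sub>m(1) by (simp add: invariant_def)
    moreover have "\<epsilon> \<le> L * R * \<delta> ^ fst c" using expanded_depth[OF cert that] by simp
    ultimately show ?thesis by (simp add: m_def)
  qed
  have sep: "q * min (m b) (m c) \<le> L * N (point b - point c)"
    if b: "b \<in> ?E" and c: "c \<in> ?E" and "b \<noteq> c" for b c
  proof -
    have "min (m b) (m c) \<le> L * R * \<delta> ^ max (fst b) (fst c)"
      using m_le[OF b] m_le[OF c] by (auto simp: max_def min_le_iff_disj)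
    then have "q * min (m b) (m c) \<le> q * (L * R * \<delta> ^ max (fst b) (fst c))"
      using q(1) by simp
    also have "\<dots> \<le> \<nu> / R * (L * R * \<delta> ^ max (fst b) (fst c))"
      using L_pos radius_pos ratio_pos by (intro mult_right_mono) (simp_all add: q_def)
    also have "\<dots> = L * (\<nu> * \<delta> ^ max (fst b) (fst c))" using radius_pos by simp
    also have "\<dots> \<le> L * N (point b - point c)"
    proof (rule mult_left_mono)
      show "\<nu> * \<delta> ^ max (fst b) (fst c) \<le> N (point b - point c)"
        using rel[OF b] rel[OF c] \<open>b \<noteq> c\<close> by (intro rep_separation) (simp_all add: relevant_def)
    qed (use L_pos in simp)
    finally show ?thesis .
  qed
  show ?thesis
  proof (rule card_separated_le_gap_integral[OF f x\<^sub>m eps(1) volume gamma q finite_expanded])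
    fix b c assume "b \<in> ?E" "c \<in> ?E" "b \<noteq> c"
    then show "q * min (max (f x\<^sub>m - f (point b)) \<epsilon>) (max (f x\<^sub>m - f (point c)) \<epsilon>)
        \<le> L * N (point b - point c)"
      using sep by (simp add: m_def)
  next
    fix c assume c: "c \<in> ?E"
    then show pt: "point c \<in> X" by (intro relevant_point rel)
    have "f x\<^sub>m - f (point c) \<le> L * N (x\<^sub>m - point c)"
      using f x\<^sub>m(1) pt by (force simp: L_lipschitz_iff abs_le_iff)
    then show "max (f x\<^sub>m - f (point c)) \<epsilon> < 4 * L * r\<^sub>0"
      using diam[OF x\<^sub>m(1) pt] eps(2) by simp
  qed
qed

text \<open>
  Before stopping, c.DOO has queried the root and at most \<open>K\<close> children of each expanded cell. The
  query at which it stops accounts for the second unit of the constant \<open>2\<close>. Termination is part of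
  the argument: certificates that stayed above \<open>\<epsilon>\<close> forever would let more than \<open>B\<close>
  cells be expanded.
\<close>

lemma sample_complexity_alg_le:
  fixes B :: real
  assumes "\<And>n. (\<And>m. 1 \<le> m \<Longrightarrow> m \<le> n \<Longrightarrow> \<epsilon> < certificate alg f m) \<Longrightarrow> real (card (expanded (run f n))) \<le> B"
  shows "ereal_of_enat (sample_complexity alg f \<epsilon>) \<le> ereal (2 + real K * B)"
proof -
  have bound: "real n \<le> 1 + real K * B"
    if "\<And>m. 1 \<le> m \<Longrightarrow> m \<le> n \<Longrightarrow> \<epsilon> < certificate alg f m" for n
  proof -
    have "n \<le> 1 + K * card (expanded (run f n))"
      using invariant_run[of f n] length_evals_run[of f n] by (simp add: invariant_def)
    then have "real n \<le> 1 + real K * real (card (expanded (run f n)))"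
      by (metis of_nat_1 of_nat_add of_nat_le_iff of_nat_mult)
    also have "\<dots> \<le> 1 + real K * B" using assms[OF that] by (simp add: mult_left_mono)
    finally show ?thesis .
  qed
  define stop where "stop n \<longleftrightarrow> 1 \<le> n \<and> certificate alg f n \<le> \<epsilon>" for n
  have "\<exists>n. stop n"
  proof (rule ccontr)
    assume "\<nexists>n. stop n"
    then have "\<epsilon> < certificate alg f m" if "1 \<le> m" for m
      using that unfolding stop_def by (meson not_le)
    then have *: "real n \<le> 1 + real K * B" for n by (rule bound)
    obtain n where "1 + real K * B < real n" using reals_Archimedean2 by blast
    then show False using *[of n] by simp
  qed
  define n where "n = (LEAST n. stop n)"
  have "stop n" unfolding n_def using \<open>\<exists>n. stop n\<close> by (rule LeastI_ex)
  have "real (n - 1) \<le> 1 + real K * B"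
  proof (rule bound)
    fix m assume "1 \<le> m" "m \<le> n - 1"
    then have "m < n" by simp
    then have "\<not> stop m" unfolding n_def by (rule not_less_Least)
    then show "\<epsilon> < certificate alg f m" using \<open>1 \<le> m\<close> by (simp add: stop_def)
  qed
  then have "real n \<le> 2 + real K * B" using \<open>stop n\<close> by (simp add: stop_def of_nat_diff)
  moreover have "sample_complexity alg f \<epsilon> \<le> enat n"
    unfolding sample_complexity_def using \<open>stop n\<close> by (intro Inf_lower) (auto simp: stop_def)
  then have "ereal_of_enat (sample_complexity alg f \<epsilon>) \<le> ereal_of_enat (enat n)"
    by (simp only: ereal_of_enat_le_iff)
  ultimately show ?thesis by (simp add: order.trans)
qed

end

section \<open>The two-sided bound\<close>

lemma Inf_enat_mem:
  fixes S :: "enat set"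
  assumes "S \<noteq> {}"
  shows "Inf S \<in> S"
  using assms LeastI_ex[of "\<lambda>x. x \<in> S"] by (auto simp: Inf_enat_def)

lemma le_INF_sample_complexity:
  assumes "\<And>A n. A \<in> S \<Longrightarrow> 1 \<le> n \<Longrightarrow> certificate A f n \<le> \<epsilon> \<Longrightarrow> b \<le> real n"
  shows "ereal b \<le> ereal_of_enat (INF A\<in>S. sample_complexity A f \<epsilon>)"
proof (cases "INF A\<in>S. sample_complexity A f \<epsilon>")
  case (enat k)
  then have "S \<noteq> {}" by (auto simp: top_enat_def)
  then have "(INF A\<in>S. sample_complexity A f \<epsilon>) \<in> (\<lambda>A. sample_complexity A f \<epsilon>) ` S"
    by (intro Inf_enat_mem) simp
  then obtain A where A: "A \<in> S" "sample_complexity A f \<epsilon> = enat k" using enat by auto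
  let ?T = "{enat n | n. 1 \<le> n \<and> certificate A f n \<le> \<epsilon>}"
  have "?T \<noteq> {}" using A(2) unfolding sample_complexity_def by (metis Inf_empty enat.distinct(1) top_enat_def)
  then have "enat k \<in> ?T" using Inf_enat_mem[of ?T] A(2) unfolding sample_complexity_def by metis
  then show ?thesis using assms[OF A(1)] enat by auto
qed simp

lemma let_witnesses:
  assumes "P a b"
  shows "let Q = P in (\<exists>x y. Q x y) \<and> Q a b"
  using assms by (auto simp: Let_def)

theorem theorem3:
  fixes N :: "real ^ 'd \<Rightarrow> real"
    and X :: "(real ^ 'd) set"
    and L \<epsilon>\<^sub>0 r\<^sub>0 \<gamma> \<delta> R \<nu> :: real
    and K :: nat
    and C :: "nat \<Rightarrow> nat \<Rightarrow> (real ^ 'd) set"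
    and ch :: "nat \<Rightarrow> nat \<Rightarrow> nat list"
    and rep :: "nat \<Rightarrow> nat \<Rightarrow> real ^ 'd"
    and tie pick :: "real list \<Rightarrow> (nat \<times> nat) set \<Rightarrow> nat \<times> nat"
  assumes X: "X \<noteq> {}" "compact X"
    and N: "is_norm N"
    and L: "0 < L"
    and eps0: "\<epsilon>\<^sub>0 = L * Sup {N (x - y) | x y. x \<in> X \<and> y \<in> X}"
    and r0: "\<epsilon>\<^sub>0 / (2 * L) < r\<^sub>0"
    and gamma: "0 < \<gamma>" "\<gamma> \<le> 1"
    and volume: "\<And>x r. x \<in> X \<Longrightarrow> 0 < r \<Longrightarrow> r < r\<^sub>0 \<Longrightarrow>
                   measure lebesgue (nball N r x \<inter> X) \<ge> \<gamma> * ball_volume N r"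
    and cells: "cell_hierarchy X K C ch rep"
    and D1: "cond_D1 N K C \<delta> R"
    and D2: "cond_D2 N K rep \<delta> \<nu>"
    and rules: "selection_rule tie" "selection_rule pick"
  shows
    "let bounds = (\<lambda>c\<^sub>d C\<^sub>d :: real. 0 < c\<^sub>d \<and> 0 < C\<^sub>d \<and>
           (\<forall>f \<in> F_class N X L. \<forall>x\<^sub>m \<in> X. (\<forall>x\<in>X. f x \<le> f x\<^sub>m) \<longrightarrow>
              (\<forall>\<epsilon>. 0 < \<epsilon> \<and> \<epsilon> \<le> \<epsilon>\<^sub>0 \<longrightarrow>
                 ereal (c\<^sub>d * (1 - Lip N X f / L) ^ CARD('d) / (1 + \<lceil>log 2 (\<epsilon>\<^sub>0 / \<epsilon>)\<rceil>) *
                        (LINT x:X|lebesgue. 1 / (f x\<^sub>m - f x + \<epsilon>) ^ CARD('d)))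
                   \<le> ereal_of_enat (INF A\<in>certified_algorithms N X L. sample_complexity A f \<epsilon>) \<and>
                 (INF A\<in>certified_algorithms N X L. sample_complexity A f \<epsilon>)
                   \<le> sample_complexity (cDOO X L R \<delta> C ch rep tie pick) f \<epsilon> \<and>
                 ereal_of_enat (sample_complexity (cDOO X L R \<delta> C ch rep tie pick) f \<epsilon>)
                   \<le> ereal (C\<^sub>d * (LINT x:X|lebesgue. 1 / (f x\<^sub>m - f x + \<epsilon>) ^ CARD('d))))))
     in (\<exists>c\<^sub>d C\<^sub>d. bounds c\<^sub>d C\<^sub>d) \<and>
        bounds
          (L ^ CARD('d) / (4 * 2 ^ (7 * CARD('d)) * ball_volume N 1))
          ((2 + real K * (of_bool (\<nu> / R \<ge> 1) + of_bool (\<nu> / R < 1) * (4 * R / \<nu>) ^ CARD('d))) *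
             ((128 * L) ^ CARD('d) / (ball_volume N 1 * \<gamma>)))"
proof (rule let_witnesses, intro conjI ballI allI impI; (elim conjE)?)
  interpret doo N X L \<delta> R \<nu> K C ch rep tie pick
    using X N L cells D1 D2 rules by unfold_locales
  let ?n = "CARD('d)" and ?v = "ball_volume N 1"
  let ?w = "of_bool (\<nu> / R \<ge> 1) + of_bool (\<nu> / R < 1) * (4 * R / \<nu>) ^ ?n :: real"
  let ?c = "L ^ ?n / (4 * 2 ^ (7 * ?n) * ?v)"
  let ?C = "(2 + real K * ?w) * ((128 * L) ^ ?n / (?v * \<gamma>))"
  have nu: "0 < \<nu>" using D2 by (simp add: cond_D2_def)
  have w: "0 \<le> ?w" using nu radius_pos by simp
  show "0 < ?c" using L ball_volume_pos by simp
  have "0 < 2 + real K * ?w" using w by (simp add: add_pos_nonneg)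
  moreover have "0 < (128 * L) ^ ?n / (?v * \<gamma>)" using L ball_volume_pos gamma by simp
  ultimately show "0 < ?C" by (rule mult_pos_pos)

  fix f x\<^sub>m \<epsilon>
  assume f: "f \<in> F_class N X L" and x\<^sub>m: "x\<^sub>m \<in> X" "\<forall>x\<in>X. f x \<le> f x\<^sub>m"
    and eps: "0 < \<epsilon>" "\<epsilon> \<le> \<epsilon>\<^sub>0"
  let ?I = "LINT x:X|lebesgue. 1 / (f x\<^sub>m - f x + \<epsilon>) ^ ?n"
  have I: "?I = gap_integral f x\<^sub>m \<epsilon>" by (simp add: gap_integral_def)
  have f_lip: "is_lipschitz N X f" "Lip N X f < L" using f by (auto simp: F_class_def)
  then have f_L: "L_lipschitz N X L f" by (simp add: L_lipschitz_def)
  have max: "\<And>x. x \<in> X \<Longrightarrow> f x \<le> f x\<^sub>m" using x\<^sub>m(2) by blast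
  have I_nonneg: "0 \<le> ?I" unfolding I using gap_integral_nonneg[of f x\<^sub>m, OF max eps(1)] .

  show "ereal (?c * (1 - Lip N X f / L) ^ ?n / (1 + \<lceil>log 2 (\<epsilon>\<^sub>0 / \<epsilon>)\<rceil>) * ?I)
      \<le> ereal_of_enat (INF A\<in>certified_algorithms N X L. sample_complexity A f \<epsilon>)"
  proof (rule le_INF_sample_complexity)
    fix A n assume A: "A \<in> certified_algorithms N X L" "1 \<le> n" "certificate A f n \<le> \<epsilon>"
    define T where "T = ((1 - Lip N X f / L) * L) ^ ?n / ?v * ?I"
    define k where "k = real_of_int \<lceil>log 2 (\<epsilon>\<^sub>0 / \<epsilon>)\<rceil>"
    have "0 \<le> T"
      unfolding T_def using f_lip L ball_volume_pos I_nonneg by (simp add: less_imp_le)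
    have "0 \<le> log 2 (\<epsilon>\<^sub>0 / \<epsilon>)" using eps by (simp add: zero_le_log_cancel_iff)
    then have "0 \<le> \<lceil>log 2 (\<epsilon>\<^sub>0 / \<epsilon>)\<rceil>" by linarith
    then have "0 \<le> k" by (simp only: k_def of_int_0_le_iff)
    \<comment> \<open>Since \<open>\<epsilon> \<le> \<epsilon>\<^sub>0\<close>, the denominator of the claim is at least the factor \<open>2\<close> lost in \<open>n + 1 \<le> 2 * n\<close>.\<close>
    have "(2 :: real) * 1 \<le> (4 * 2 ^ (7 * ?n)) * (1 + k)"
    proof (rule mult_mono)
      have "(1 :: real) \<le> 2 ^ (7 * ?n)" by simp
      then show "(2 :: real) \<le> 4 * 2 ^ (7 * ?n)" by linarith
    qed (use \<open>0 \<le> k\<close> in simp_all)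
    then have "T / ((4 * 2 ^ (7 * ?n)) * (1 + k)) \<le> T / 2"
      using \<open>0 \<le> T\<close> by (intro divide_left_mono) auto
    moreover have "?c * (1 - Lip N X f / L) ^ ?n / (1 + k) * ?I = T / ((4 * 2 ^ (7 * ?n)) * (1 + k))"
      by (simp add: T_def power_mult_distrib mult_ac)
    moreover have "T / 2 \<le> real n"
      using certified_lower_bound[OF A(1) f_lip x\<^sub>m(1) max eps(1) A(2,3)] by (simp add: T_def I)
    ultimately show "?c * (1 - Lip N X f / L) ^ ?n / (1 + \<lceil>log 2 (\<epsilon>\<^sub>0 / \<epsilon>)\<rceil>) * ?I \<le> real n"
      unfolding k_def of_int_add of_int_1 by linarith
  qed

  show "(INF A\<in>certified_algorithms N X L. sample_complexity A f \<epsilon>) \<le> sample_complexity alg f \<epsilon>"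
    by (rule INF_lower[OF alg_certified])

  show "ereal_of_enat (sample_complexity alg f \<epsilon>) \<le> ereal (?C * ?I)"
  proof -
    define \<Phi> where "\<Phi> = (128 * L) ^ ?n / (?v * \<gamma>) * ?I"
    define q where "q = min (\<nu> / R) 1"
    have "\<epsilon>\<^sub>0 < 2 * L * r\<^sub>0" using r0 L by (simp add: field_simps)
    moreover have "0 < \<epsilon>\<^sub>0" using eps by simp
    ultimately have eps0_less: "\<epsilon>\<^sub>0 < 4 * L * r\<^sub>0" by linarith
    have diam: "L * N (x - y) < 4 * L * r\<^sub>0" if "x \<in> X" "y \<in> X" for x y
    proof -
      have "L * N (x - y) \<le> \<epsilon>\<^sub>0" unfolding eps0
        using N_diff_le_diameter[OF that] L by (intro mult_left_mono) auto
      then show ?thesis using eps0_less by simp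
    qed
    have eps_less: "\<epsilon> < 4 * L * r\<^sub>0" using eps(2) eps0_less by simp
    \<comment> \<open>The constant \<open>2\<close> is absorbed by applying the packing bound to the single point \<open>x\<^sub>m\<close>.\<close>
    have "real (card {()}) \<le> (9 * L / 1) ^ ?n / (?v * \<gamma>) * gap_integral f x\<^sub>m \<epsilon>"
      by (rule card_separated_le_gap_integral[where p = "\<lambda>_. x\<^sub>m" and r\<^sub>0 = r\<^sub>0,
            OF f_L x\<^sub>m(1) max eps(1) volume gamma(1)])
         (use x\<^sub>m(1) eps_less eps(1) in simp_all)
    also have "\<dots> \<le> \<Phi>"
      unfolding \<Phi>_def I using L gamma(1) ball_volume_pos I_nonneg[unfolded I]
      by (intro mult_right_mono divide_right_mono power_mono) simp_all
    finally have "1 \<le> \<Phi>" by simp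
    have "(9 * L / q) ^ ?n \<le> ?w * (128 * L) ^ ?n"
    proof (cases "\<nu> / R \<ge> 1")
      case True
      then show ?thesis using L by (simp add: q_def power_mono)
    next
      case False
      then have "9 * L / q = 9 * L * R / \<nu>" by (simp add: q_def)
      also have "\<dots> \<le> 4 * R / \<nu> * (128 * L)" using L radius_pos nu by (simp add: divide_right_mono)
      finally have "(9 * L / q) ^ ?n \<le> (4 * R / \<nu> * (128 * L)) ^ ?n"
        using L nu radius_pos by (intro power_mono) (simp_all add: q_def)
      also have "\<dots> = (4 * R / \<nu>) ^ ?n * (128 * L) ^ ?n" by (rule power_mult_distrib)
      finally show ?thesis using False by simp
    qed
    then have "(9 * L / q) ^ ?n / (?v * \<gamma>) * gap_integral f x\<^sub>m \<epsilon>
        \<le> ?w * (128 * L) ^ ?n / (?v * \<gamma>) * gap_integral f x\<^sub>m \<epsilon>"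
      using gamma(1) ball_volume_pos I_nonneg[unfolded I]
      by (intro mult_right_mono divide_right_mono) simp_all
    also have "\<dots> = ?w * \<Phi>" by (simp add: \<Phi>_def I)
    finally have expansions: "(9 * L / q) ^ ?n / (?v * \<gamma>) * gap_integral f x\<^sub>m \<epsilon> \<le> ?w * \<Phi>" .
    have "ereal_of_enat (sample_complexity alg f \<epsilon>) \<le> ereal (2 + real K * (?w * \<Phi>))"
    proof (rule sample_complexity_alg_le)
      fix n assume "\<And>m. 1 \<le> m \<Longrightarrow> m \<le> n \<Longrightarrow> \<epsilon> < certificate alg f m"
      from card_expanded_le[OF f_L x\<^sub>m(1) max eps(1) eps_less diam gamma(1) volume this, folded q_def] expansions
      show "real (card (expanded (run f n))) \<le> ?w * \<Phi>" by (rule order.trans)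
    qed
    moreover have "2 + real K * (?w * \<Phi>) \<le> ?C * ?I"
    proof -
      have "2 + real K * (?w * \<Phi>) \<le> 2 * \<Phi> + real K * (?w * \<Phi>)" using \<open>1 \<le> \<Phi>\<close> by linarith
      also have "\<dots> = (2 + real K * ?w) * \<Phi>"
        by (rule trans[OF _ distrib_right[symmetric]]) (simp only: mult.assoc)
      also have "\<dots> = ?C * ?I" unfolding \<Phi>_def by (rule mult.assoc[symmetric])
      finally show ?thesis .
    qed
    then have "ereal (2 + real K * (?w * \<Phi>)) \<le> ereal (?C * ?I)" by (simp only: ereal_less_eq(3))
    ultimately show ?thesis by (rule order.trans)
  qed
qed

end
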